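(* Let $m>0$, $t\ge0$, $p\ge1$, and $n$ with $n-p-t\ge1$, and let $\gamma=[1^t,p,n-p-t]\vdash n$ be the partition consisting of $t$ parts equal to $1$ together with the two parts $p$ and $n-p-t$. If $n-m-t$ is odd, then $$\frac{\mu_{n,m}(\gamma)}{|\mathcal{C}_\gamma|}=\sum_{j=1}^{n-t}\frac{(-1)^{n-j-t}-(-1)^{j-m}}{j!}\binom{p}{n+1-j-t}{j\brack m},$$ and if $n-m-t$ is even, then $\mu_{n,m}(\gamma)=0$.
   Context: Fix $\omega=(1\,2\,\cdots\,n)$. For $\gamma\vdash n$ and $m\ge1$, $\mu_{n,m}(\gamma)$ is the number of pairs $(\sigma,\pi)$ of permutations of $[n]$ with $\sigma\pi=\omega$, $\sigma$ of cycle type $\gamma$, and $\pi$ having exactly $m$ cycles. $|\mathcal{C}_\gamma|$ is the number of permutations of $[n]$ of cycle type $\gamma$. ${j\brack m}$ is the unsigned Stirling number of the first kind (zero if $m>j$); $\binom{p}{k}=0$ if $k<0$ or $k>p$. *)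

theory Defs
  imports Complex_Main "HOL-Combinatorics.Combinatorics" "HOL-Library.Multiset"
begin

definition long_cycle :: "nat \<Rightarrow> nat \<Rightarrow> nat" where
  "long_cycle n x = (if x \<in> {1..n} then (if x = n then 1 else x + 1) else x)"

definition perm_cycles :: "nat \<Rightarrow> (nat \<Rightarrow> nat) \<Rightarrow> nat set set" where
  "perm_cycles n f = (\<lambda>x. orbit f x) ` {1..n}"

definition cycle_type :: "nat \<Rightarrow> (nat \<Rightarrow> nat) \<Rightarrow> nat multiset" where
  "cycle_type n f = image_mset card (mset_set (perm_cycles n f))"

definition num_cycles :: "nat \<Rightarrow> (nat \<Rightarrow> nat) \<Rightarrow> nat" where
  "num_cycles n f = card (perm_cycles n f)"

definition mu :: "nat \<Rightarrow> nat \<Rightarrow> nat multiset \<Rightarrow> nat" where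
  "mu n m \<gamma> = card {(\<sigma>, \<pi>). \<sigma> permutes {1..n} \<and> \<pi> permutes {1..n} \<and>
      \<sigma> \<circ> \<pi> = long_cycle n \<and> cycle_type n \<sigma> = \<gamma> \<and> num_cycles n \<pi> = m}"

definition conj_class_size :: "nat \<Rightarrow> nat multiset \<Rightarrow> nat" where
  "conj_class_size n \<gamma> = card {\<sigma>. \<sigma> permutes {1..n} \<and> cycle_type n \<sigma> = \<gamma>}"

end

theory Submission
  imports Defs "HOL-Computational_Algebra.Formal_Power_Series"
begin

text \<open>
  By conjugation, the quotient equals 1/(n-1)! times the number of long cycles w, for a fixed s of
  type gamma, such that the permutation inv s o w has m cycles. Only hook characters are nonzero on
  long cycles, which suggests expanding the indicator of the long cycles into Young
  symmetrizers of hooks. For a fixed point a and a set D not containing a, let h(D, w) be the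
  coefficient of w in the product of the antisymmetrizer of D + a and the symmetrizer of the
  complement of D: it is the sign of u if w = u v with u permuting D + a and v fixing D, and 0 if
  there is no such decomposition. Two facts suffice.

  First, as a function of w, h(D, w) is an eigenvector of the convolution with x to the power of
  the number of cycles. This convolution is the product of the factors x + J, J running through
  the Jucys-Murphy elements, and if the points of D + a come first, each J acts as a scalar.

  Second, a D with h(D, w) nonzero consists of whole cycles of w that avoid a and of a final segment
  of the cycle through a. Hence the sum of (-1)^|D| h(D, w) c(|D|) over D is computed one
  cycle at a time, each cycle of length l replacing c(k) by c(k) - c(k + l). For c = 1 the result
  is n times the indicator of the long cycles. For the eigenvalues c(k) = (x - k)(x - k + 1)...(x - k + n - 1)
  the fixed points only contribute a constant, and the cycles of lengths p and n - p - t give a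
  sum of p differences of rising factorials, which Vandermonde's identity turns into the claimed one.
\<close>

section \<open>Counting cycles\<close>

definition cycle_count :: "'a set \<Rightarrow> ('a \<Rightarrow> 'a) \<Rightarrow> nat" where
  "cycle_count S f = card (orbit f ` S)"

lemma card_image_cong_kernel:
  assumes "\<And>x y. x \<in> S \<Longrightarrow> y \<in> S \<Longrightarrow> f x = f y \<longleftrightarrow> g x = g y"
  shows "card (f ` S) = card (g ` S)"
proof (rule bij_betw_same_card)
  define h where "h z = g (SOME x. x \<in> S \<and> f x = z)" for z
  have h: "h (f x) = g x" if "x \<in> S" for x
  proof -
    have "(SOME y. y \<in> S \<and> f y = f x) \<in> S \<and> f (SOME y. y \<in> S \<and> f y = f x) = f x"
      using that by (intro someI[of "\<lambda>y. y \<in> S \<and> f y = f x" x]) auto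
    then show ?thesis
      using assms that unfolding h_def by blast
  qed
  show "bij_betw h (f ` S) (g ` S)"
    unfolding bij_betw_def
  proof
    show "inj_on h (f ` S)"
      by (auto intro!: inj_onI simp: h assms)
    show "h ` f ` S = g ` S"
      by (auto simp: h image_image)
  qed
qed

lemma orbit_eq_iff:
  assumes "permutation f"
  shows "orbit f x = orbit f y \<longleftrightarrow> y \<in> orbit f x"
  using assms by (metis cyclic_on_orbit' orbit_cyclic_eq3 permutation_self_in_orbit)

text \<open>Composing with \<open>transpose j i\<close> on the left inserts \<open>j\<close> into
  the cycle of \<open>q\<close> just before \<open>i\<close>: the point formerly sent to
  \<open>i\<close> now goes to \<open>j\<close>, and \<open>j\<close> goes to \<open>i\<close>. Seen
  from \<open>S\<close>, the cycles stay the same.\<close>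

lemma orbit_transpose_compose_iff:
  assumes q: "q permutes S" "finite S" and "j \<notin> S" "i \<in> S" "x \<in> S" "y \<in> S"
  shows "y \<in> orbit (transpose j i \<circ> q) x \<longleftrightarrow> y \<in> orbit q x"
proof -
  let ?q = "transpose j i \<circ> q"
  have qj: "q j = j"
    using q assms(3) by (simp add: permutes_not_in)
  have ij: "i \<noteq> j"
    using assms by auto
  \<comment> \<open>The second conjunct covers the detour: arriving at \<open>j\<close> in the new
    cycle stands for arriving at \<open>i\<close> in the old one.\<close>
  have "(z \<noteq> j \<longrightarrow> z \<in> orbit q x) \<and> (z = j \<longrightarrow> i \<in> orbit q x)" if "z \<in> orbit ?q x" for z
    using that
  proof induction
    case base
    have "q x \<noteq> j"
      using assms permutes_in_image[OF q(1)] by metis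
    then show ?case
      using orbit.base[of q x] by (auto simp: transpose_def)
  next
    case (step z)
    show ?case
    proof (cases "z = j")
      case True
      then have "?q z = i" using qj by simp
      then show ?thesis
        using step(2) True ij by simp
    next
      case False
      then have z: "q z \<in> orbit q x" using step(2) orbit.step[of z q x] by simp
      moreover have "q z \<noteq> j" using False qj permutes_inj[OF q(1)] by (metis injD)
      ultimately show ?thesis
        by (auto simp: transpose_def)
    qed
  qed
  moreover have "z \<in> orbit ?q x" if "z \<in> orbit q x" for z
    using that
  proof induction
    case base
    show ?case
    proof (cases "q x = i")
      case True
      then have "?q x = j" "?q j = i" using qj by auto
      then show ?thesis
        using True orbit.base[of ?q x] orbit.step[of j ?q x] by metis
    next
      case False
      moreover have "q x \<noteq> j" using assms permutes_in_image[OF q(1)] by metis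
      ultimately have "?q x = q x" by (simp add: transpose_def)
      then show ?thesis
        using orbit.base[of ?q x] by metis
    qed
  next
    case (step z)
    have "z \<in> S" using step(1) permutes_orbit_subset[OF q(1) assms(5)] by auto
    show ?case
    proof (cases "q z = i")
      case True
      then have "?q z = j" "?q j = i" using qj by auto
      then show ?thesis
        using True orbit.step[OF step(2)] orbit.step[of j ?q x] by metis
    next
      case False
      moreover have "q z \<noteq> j" using assms permutes_in_image[OF q(1)] \<open>z \<in> S\<close> by metis
      ultimately have "?q z = q z" by (simp add: transpose_def)
      then show ?thesis
        using orbit.step[OF step(2)] by metis
    qed
  qed
  ultimately show ?thesis
    using assms by auto
qed

lemma cycle_count_transpose_compose:
  assumes q: "q permutes S" "finite S" and "j \<notin> S" "i \<in> S"
  shows "cycle_count (insert j S) (transpose j i \<circ> q) = cycle_count S q"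
proof -
  let ?q = "transpose j i \<circ> q"
  have qj: "q j = j"
    using q assms(3) by (simp add: permutes_not_in)
  have perm: "permutation q" "permutation ?q"
    using permutes_imp_permutation[OF q(2,1)] by (auto intro: permutation_compose permutation_swap_id)
  have "orbit ?q i = orbit ?q j"
    using permutation_orbit_step[OF perm(2), of j] qj by simp
  then have "orbit ?q ` insert j S = orbit ?q ` S"
    using assms(4) by (metis image_insert insert_absorb imageI)
  moreover have "card (orbit ?q ` S) = card (orbit q ` S)"
    by (rule card_image_cong_kernel)
       (simp only: orbit_eq_iff perm orbit_transpose_compose_iff[OF assms])
  ultimately show ?thesis
    by (simp add: cycle_count_def)
qed

lemma cycle_count_insert_fixed:
  assumes q: "q permutes S" "finite S" and "j \<notin> S"
  shows "cycle_count (insert j S) q = Suc (cycle_count S q)"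
proof -
  have "orbit q j = {j}"
    using q assms(3) by (simp add: permutes_not_in orbit_eq_singleton_iff)
  moreover have "{j} \<notin> orbit q ` S"
    using permutes_orbit_subset[OF q(1)] assms(3) by auto
  ultimately show ?thesis
    using q by (simp add: cycle_count_def)
qed

lemma cycle_count_le: "finite S \<Longrightarrow> cycle_count S q \<le> card S"
  by (simp add: cycle_count_def card_image_le)

text \<open>Every permutation of \<open>insert j S\<close> is uniquely \<open>transpose j b\<close>
  after a permutation of \<open>S\<close>. For \<open>b = j\<close> the point \<open>j\<close> is a
  new cycle; otherwise it joins an existing one. With \<open>F\<close> a power of x times a function
  of the permutation, this splits off the factor x + J, where J is the Jucys-Murphy element of
  \<open>j\<close>.\<close>

lemma sum_permutes_insert_cycles:
  fixes F :: "nat \<Rightarrow> ('a \<Rightarrow> 'a) \<Rightarrow> 'b::comm_monoid_add"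
  assumes "finite S" "j \<notin> S"
  shows "(\<Sum>\<pi> | \<pi> permutes insert j S. F (cycle_count (insert j S) \<pi>) \<pi>) =
    (\<Sum>q | q permutes S. F (Suc (cycle_count S q)) q + (\<Sum>i\<in>S. F (cycle_count S q) (transpose j i \<circ> q)))"
  (is "?L = ?R")
proof -
  have "?L = (\<Sum>b\<in>insert j S. \<Sum>q | q permutes S.
      F (cycle_count (insert j S) (transpose j b \<circ> q)) (transpose j b \<circ> q))"
    by (rule sum_over_permutations_insert[OF assms])
  also have "\<dots> = (\<Sum>q | q permutes S. F (cycle_count (insert j S) q) q) +
     (\<Sum>b\<in>S. \<Sum>q | q permutes S. F (cycle_count (insert j S) (transpose j b \<circ> q)) (transpose j b \<circ> q))"
    using assms by simp
  also have "\<dots> = (\<Sum>q | q permutes S. F (Suc (cycle_count S q)) q) +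
     (\<Sum>b\<in>S. \<Sum>q | q permutes S. F (cycle_count S q) (transpose j b \<circ> q))"
    using assms by (simp add: cycle_count_insert_fixed cycle_count_transpose_compose)
  also have "\<dots> = ?R"
    by (subst sum.swap) (simp add: sum.distrib)
  finally show ?thesis .
qed

text \<open>Adding a point as a new cycle raises both terms of the exponent and keeps the sign;
  adding it to an old cycle raises only \<open>card S\<close> and flips the sign. The sum in the
  exponent has the parity of the usual difference and avoids truncated subtraction.\<close>

lemma sign_cycle_count:
  assumes "finite S" "q permutes S"
  shows "sign q = (-1) ^ (card S + cycle_count S q)"
  using assms
proof (induction S arbitrary: q rule: finite_induct)
  case empty
  then show ?case
    by (simp add: cycle_count_def)
next
  case (insert j S)
  then have "q \<in> (\<lambda>(b, p). transpose j b \<circ> p) ` {(b, p). b \<in> insert j S \<and> p \<in> {p. p permutes S}}"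
    using permutes_insert[of j S] by blast
  then obtain b p where bp: "b \<in> insert j S" "p permutes S" "q = transpose j b \<circ> p"
    by auto
  show ?case
  proof (cases "b = j")
    case True
    then show ?thesis
      using bp insert cycle_count_insert_fixed[OF bp(2) insert(1,2)] by simp
  next
    case False
    then have "b \<in> S" using bp by auto
    have "sign q = - sign p"
      using bp False insert permutes_imp_permutation[OF insert(1) bp(2)]
      by (simp add: sign_compose permutation_swap_id sign_swap_id)
    then show ?thesis
      using insert(1,2) insert.IH[OF bp(2)]
        cycle_count_transpose_compose[OF bp(2) insert(1,2) \<open>b \<in> S\<close>, folded bp(3)] by simp
  qed
qed

lemma sign_single_orbit:
  assumes "finite S" "q permutes S" "a \<in> S" "orbit q a = S"
  shows "sign q = (-1) ^ (card S - 1)"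
proof -
  have "orbit q x = S" if "x \<in> S" for x
    using that assms cyclic_on_orbit orbit_cyclic_eq3 by metis
  then have "orbit q ` S = {S}"
    using assms(3) by auto
  then have "sign q = (-1) ^ (card S + 1)"
    using sign_cycle_count[OF assms(1,2)] by (simp add: cycle_count_def)
  moreover have "card S > 0"
    using assms by (auto simp: card_gt_0_iff)
  ultimately show ?thesis
    by (cases "card S") auto
qed

section \<open>Coefficients of Young symmetrizers of hooks\<close>

text \<open>
  There is at most one summand, because u is determined on all but one point of insert a D; the sum is
  0 if w does not map D into insert a D.
\<close>

definition hook_coeff :: "'a \<Rightarrow> 'a set \<Rightarrow> ('a \<Rightarrow> 'a) \<Rightarrow> real" where
  "hook_coeff a D w = (\<Sum>u | u permutes insert a D \<and> (\<forall>d\<in>D. u d = w d). of_int (sign u))"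

section \<open>Left multiplication of the argument of \<open>hook_coeff\<close> by
  transpositions\<close>

lemma sign_transpose_compose:
  assumes "finite A" "u permutes A" "i \<noteq> j"
  shows "sign (transpose i j \<circ> u) = - sign u" "sign (u \<circ> transpose i j) = - sign u"
  using permutes_imp_permutation[OF assms(1,2)] assms(3)
  by (simp_all add: sign_compose permutation_swap_id sign_swap_id)

text \<open>Composing each \<open>u\<close> with the same transposition matches the two index sets
  and reverses every sign.\<close>

lemma hook_coeff_antisym:
  assumes "finite D" "i \<in> insert a D" "j \<in> insert a D" "i \<noteq> j"
  shows "hook_coeff a D (transpose j i \<circ> w) = - hook_coeff a D w"
proof -
  let ?t = "transpose j i"
  have t: "?t permutes insert a D"
    using assms by (intro permutes_swap_id) auto
  have "hook_coeff a D (?t \<circ> w) =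
     (\<Sum>u | u permutes insert a D \<and> (\<forall>d\<in>D. u d = w d). of_int (- sign u))"
    unfolding hook_coeff_def
  proof (rule sum.reindex_bij_witness[of _ "\<lambda>u. ?t \<circ> u" "\<lambda>u. ?t \<circ> u"])
    fix u assume u: "u \<in> {u. u permutes insert a D \<and> (\<forall>d\<in>D. u d = (?t \<circ> w) d)}"
    then show "of_int (- sign (?t \<circ> u)) = (of_int (sign u) :: real)"
      using sign_transpose_compose(1)[of "insert a D" u j i] assms by simp
    show "?t \<circ> u \<in> {u. u permutes insert a D \<and> (\<forall>d\<in>D. u d = w d)}"
      using u permutes_compose[OF _ t] by simp
  next
    fix u assume u: "u \<in> {u. u permutes insert a D \<and> (\<forall>d\<in>D. u d = w d)}"
    then show "?t \<circ> u \<in> {u. u permutes insert a D \<and> (\<forall>d\<in>D. u d = (?t \<circ> w) d)}"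
      using u permutes_compose[OF _ t] by simp
  qed (simp_all flip: o_assoc add: fun_eq_iff)
  then show ?thesis
    by (simp add: hook_coeff_def sum_negf)
qed

text \<open>All values \<open>u d\<close> lie in \<open>insert a D\<close>, which the transposition
  fixes pointwise, so both arguments impose the same conditions on \<open>u\<close>.\<close>

lemma hook_coeff_outside:
  assumes "i \<notin> insert a D" "j \<notin> insert a D"
  shows "hook_coeff a D (transpose j i \<circ> w) = hook_coeff a D w"
proof -
  have "u d = (transpose j i \<circ> w) d \<longleftrightarrow> u d = w d" if "u permutes insert a D" "d \<in> D" for u d
  proof -
    have "u d \<in> insert a D"
      using that permutes_in_image by fastforce
    then show ?thesis
      using assms by (auto simp: transpose_def)
  qed
  then have "{u. u permutes insert a D \<and> (\<forall>d\<in>D. u d = (transpose j i \<circ> w) d)} =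
     {u. u permutes insert a D \<and> (\<forall>d\<in>D. u d = w d)}"
    by blast
  then show ?thesis
    unfolding hook_coeff_def by metis
qed

text \<open>A Garnir-type relation: the transpositions joining an outside point \<open>j\<close> to
  all of \<open>insert a D\<close> act together as the scalar 1. After exchanging the sums, each
  \<open>u\<close> is compatible with at most one \<open>i\<close>; the proof splits on whether
  \<open>w\<close> takes the value \<open>j\<close> on \<open>D\<close>.\<close>

lemma hook_coeff_transversal:
  assumes D: "finite D" "a \<notin> D" and j: "j \<notin> insert a D" and w: "inj w"
  shows "(\<Sum>i\<in>insert a D. hook_coeff a D (transpose j i \<circ> w)) = hook_coeff a D w"
proof -
  let ?A = "insert a D"
  let ?S = "{u. u permutes ?A}"
  define E where "E i u \<longleftrightarrow> (\<forall>d\<in>D. u d = transpose j i (w d))" for i u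
  have fin: "finite ?S"
    using D by (simp add: finite_permutations)
  have uD: "u d \<in> ?A" if "u \<in> ?S" "d \<in> ?A" for u d
    using that permutes_in_image[of u ?A d] by simp
  have uinj: "u d = u e \<longleftrightarrow> d = e" if "u \<in> ?S" for u d e
    using that permutes_inj[of u ?A] by (simp add: inj_eq)
  have lhs: "(\<Sum>i\<in>?A. hook_coeff a D (transpose j i \<circ> w)) =
     (\<Sum>u\<in>?S. \<Sum>i\<in>?A. if E i u then of_int (sign u) else 0)"
  proof -
    have "hook_coeff a D (transpose j i \<circ> w) = (\<Sum>u\<in>?S. if E i u then of_int (sign u) else 0)" for i
      using fin by (simp add: hook_coeff_def E_def sum.If_cases Collect_conj_eq)
    then show ?thesis
      by (simp only: sum.swap[of _ ?S])
  qed
  show ?thesis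
  proof (cases "\<exists>d0\<in>D. w d0 = j")
    case False
    \<comment> \<open>Since \<open>w\<close> avoids \<open>j\<close> on \<open>D\<close>, the value
      \<open>i\<close> cannot occur among the \<open>u d\<close> with d in \<open>D\<close>. It is
      therefore the one remaining value of \<open>u\<close>, namely \<open>u a\<close>.\<close>
    have "E i u \<longleftrightarrow> i = u a \<and> (\<forall>d\<in>D. u d = w d)" if u: "u \<in> ?S" and i: "i \<in> ?A" for i u
    proof
      assume E: "E i u"
      have eq: "u d = w d" and ne: "u d \<noteq> i" if "d \<in> D" for d
      proof -
        have 1: "u d = transpose j i (w d)" "u d \<noteq> j" "w d \<noteq> j"
          using E uD[OF u, of d] that False j by (auto simp: E_def)
        then show "u d = w d" "u d \<noteq> i"
          using i j by (auto simp: transpose_def split: if_splits)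
      qed
      have "i \<in> u ` ?A"
        using u i permutes_image by auto
      then show "i = u a \<and> (\<forall>d\<in>D. u d = w d)"
        using eq ne by auto
    next
      assume *: "i = u a \<and> (\<forall>d\<in>D. u d = w d)"
      show "E i u"
        unfolding E_def
      proof
        fix d assume "d \<in> D"
        then have "w d \<noteq> j" "w d \<noteq> i"
          using * uinj[OF u] D False by metis+
        then show "u d = transpose j i (w d)"
          using * \<open>d \<in> D\<close> by simp
      qed
    qed
    then have "(\<Sum>i\<in>?A. if E i u then of_int (sign u) else 0) =
       (if \<forall>d\<in>D. u d = w d then of_int (sign u) else 0 :: real)" if u: "u \<in> ?S" for u
    proof -
      have "(\<Sum>i\<in>?A. if E i u then of_int (sign u) else 0) =
         (\<Sum>i\<in>?A. if i = u a then (if \<forall>d\<in>D. u d = w d then of_int (sign u) else 0 :: real) else 0)"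
        using \<open>\<And>i u. u \<in> ?S \<Longrightarrow> i \<in> ?A \<Longrightarrow> E i u \<longleftrightarrow> i = u a \<and> (\<forall>d\<in>D. u d = w d)\<close> u
        by (intro sum.cong) auto
      then show ?thesis
        using D uD[OF u, of a] by (simp add: sum.delta')
    qed
    then have "(\<Sum>i\<in>?A. hook_coeff a D (transpose j i \<circ> w)) =
       (\<Sum>u\<in>?S. if \<forall>d\<in>D. u d = w d then of_int (sign u) else 0)"
      unfolding lhs by (intro sum.cong) auto
    then show ?thesis
      using fin by (simp add: hook_coeff_def sum.If_cases Collect_conj_eq)
  next
    case True
    then obtain d0 where d0: "d0 \<in> D" "w d0 = j" by blast
    \<comment> \<open>Both sides vanish: composing u with the transposition of a and d0 reverses the sign.\<close>
    define P where "P u \<longleftrightarrow> (\<forall>d\<in>D - {d0}. u d = w d)" for u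
    have wj: "w d \<noteq> j" if "d \<noteq> d0" for d
      using w d0 that by (metis injD)
    \<comment> \<open>At \<open>d0\<close> the condition reads \<open>u d0 = i\<close>. At the other
      points of \<open>D\<close> the transposition cannot act, because neither side of the equation
      may be \<open>j\<close>.\<close>
    have "E i u \<longleftrightarrow> i = u d0 \<and> P u" if u: "u \<in> ?S" and i: "i \<in> ?A" for i u
    proof
      assume E: "E i u"
      have "u d = w d" if "d \<in> D - {d0}" for d
      proof -
        have "u d = transpose j i (w d)" "u d \<noteq> j" "w d \<noteq> j"
          using E uD[OF u, of d] that wj j by (auto simp: E_def)
        then show ?thesis
          by (auto simp: transpose_def split: if_splits)
      qed
      moreover have "i = u d0"
        using E d0 by (simp add: E_def)
      ultimately show "i = u d0 \<and> P u"
        by (simp add: P_def)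
    next
      assume *: "i = u d0 \<and> P u"
      show "E i u"
        unfolding E_def
      proof
        fix d assume "d \<in> D"
        show "u d = transpose j i (w d)"
        proof (cases "d = d0")
          case True
          then show ?thesis using d0 * by simp
        next
          case False
          then have "w d \<noteq> j" "w d = u d"
            using * wj \<open>d \<in> D\<close> by (auto simp: P_def)
          moreover have "u d \<noteq> i"
            using * uinj[OF u, of d d0] False by simp
          ultimately show ?thesis by simp
        qed
      qed
    qed
    note E = this
    have "(\<Sum>i\<in>?A. if E i u then of_int (sign u) else 0) =
       (if P u then of_int (sign u) else 0 :: real)" if u: "u \<in> ?S" for u
    proof -
      have "(\<Sum>i\<in>?A. if E i u then of_int (sign u) else 0) =
         (\<Sum>i\<in>?A. if i = u d0 then (if P u then of_int (sign u) else 0 :: real) else 0)"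
        using E u by (intro sum.cong) auto
      then show ?thesis
        using D uD[OF u, of d0] d0 by (simp add: sum.delta')
    qed
    then have L: "(\<Sum>i\<in>?A. hook_coeff a D (transpose j i \<circ> w)) =
       (\<Sum>u\<in>?S. if P u then of_int (sign u) else 0)"
      unfolding lhs by (intro sum.cong) auto
    let ?t = "transpose a d0"
    have t: "?t permutes ?A"
      using d0 by (intro permutes_swap_id) auto
    have "a \<noteq> d0" using d0 D by auto
    have Pt: "P (u \<circ> ?t) \<longleftrightarrow> P u" for u
    proof -
      have "?t d = d" if "d \<in> D - {d0}" for d
        using that D by (intro transpose_apply_other) auto
      then show ?thesis
        by (simp add: P_def)
    qed
    have "(\<Sum>u\<in>?S. if P u then of_int (sign u) else 0 :: real) =
       (\<Sum>u\<in>?S. if P u then of_int (- sign u) else 0)"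
    proof (rule sum.reindex_bij_witness[of _ "\<lambda>u. u \<circ> ?t" "\<lambda>u. u \<circ> ?t"])
      fix u assume u: "u \<in> ?S"
      show "(if P (u \<circ> ?t) then of_int (- sign (u \<circ> ?t)) else 0 :: real) =
         (if P u then of_int (sign u) else 0)"
        using sign_transpose_compose(2)[of ?A u a d0] u D \<open>a \<noteq> d0\<close> by (simp add: Pt)
    qed (use permutes_compose[OF t] in \<open>simp_all add: o_assoc[symmetric]\<close>)
    also have "\<dots> = - (\<Sum>u\<in>?S. if P u then of_int (sign u) else 0 :: real)"
      by (simp add: sum_negf[symmetric] if_distrib cong: if_cong)
    finally have "(\<Sum>u\<in>?S. if P u then of_int (sign u) else 0 :: real) = 0"
      by simp
    moreover
    have "{u. u permutes ?A \<and> (\<forall>d\<in>D. u d = w d)} = {}"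
    proof -
      have "u d0 \<noteq> w d0" if "u permutes ?A" for u
        using uD[of u d0] that d0 j by auto
      then show ?thesis
        using d0 by blast
    qed
    then have "hook_coeff a D w = 0"
      by (simp only: hook_coeff_def sum.empty)
    ultimately show ?thesis
      using L by simp
  qed
qed

section \<open>Eigenvalues of the convolution with x to the number of cycles\<close>

lemma prod_descending_eq_pochhammer:
  fixes x :: real
  shows "(\<Prod>i<Suc k. x - real i) = pochhammer (x - real k) (Suc k)"
proof (induction k)
  case 0
  then show ?case by simp
next
  case (Suc k)
  have "pochhammer (x - real (Suc k)) (Suc (Suc k)) = (x - real (Suc k)) * pochhammer (x - real k) (Suc k)"
    by (subst pochhammer_rec) simp
  then show ?case
    using Suc by (simp add: mult.commute)
qed

text \<open>Inside \<open>insert a D\<close> each transposition acts by -1, so a new point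
  contributes x minus the number of points already present.\<close>

lemma cycle_sum_hook_coeff_within:
  fixes x :: real
  assumes "finite S" "S \<subseteq> insert a D" "finite D"
  shows "(\<Sum>\<pi> | \<pi> permutes S. x ^ cycle_count S \<pi> * hook_coeff a D (\<pi> \<circ> w)) =
     (\<Prod>i<card S. x - real i) * hook_coeff a D w"
  using assms
proof (induction S rule: finite_induct)
  case empty
  then show ?case by (simp add: cycle_count_def)
next
  case (insert j S)
  have "hook_coeff a D (transpose j i \<circ> q \<circ> w) = - hook_coeff a D (q \<circ> w)" if "i \<in> S" for i q
    using hook_coeff_antisym[of D i a j "q \<circ> w"] insert that by (auto simp: o_assoc)
  then have "(\<Sum>\<pi> | \<pi> permutes insert j S. x ^ cycle_count (insert j S) \<pi> * hook_coeff a D (\<pi> \<circ> w)) =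
    (\<Sum>q | q permutes S. (x - real (card S)) * (x ^ cycle_count S q * hook_coeff a D (q \<circ> w)))"
    by (subst sum_permutes_insert_cycles[OF insert(1,2)]) (simp add: algebra_simps)
  also have "\<dots> = (x - real (card S)) * ((\<Prod>i<card S. x - real i) * hook_coeff a D w)"
    using insert by (subst sum_distrib_left[symmetric]) (simp add: comp_def)
  finally show ?case
    using insert by (simp add: comp_def)
qed

text \<open>A point outside \<open>insert a D\<close> contributes x, plus 1 for all of
  \<open>insert a D\<close> together by \<open>hook_coeff_transversal\<close>, plus 1 for each
  earlier point of \<open>T\<close>. All factors together are x plus the contents of the boxes of
  the hook, which run through consecutive integers and form one rising factorial.\<close>

lemma cycle_sum_hook_coeff_extend:
  fixes x :: real
  assumes "finite T" "insert a D \<inter> T = {}" "finite D" "a \<notin> D" "inj w"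
  shows "(\<Sum>\<pi> | \<pi> permutes insert a D \<union> T. x ^ cycle_count (insert a D \<union> T) \<pi> * hook_coeff a D (\<pi> \<circ> w)) =
     pochhammer (x - real (card D)) (Suc (card D) + card T) * hook_coeff a D w"
  using assms
proof (induction T rule: finite_induct)
  case empty
  then show ?case
    using cycle_sum_hook_coeff_within[of "insert a D" a D x w] prod_descending_eq_pochhammer[of x "card D"]
    by (simp add: comp_def)
next
  case (insert j T)
  define S where "S = insert a D \<union> T"
  have S: "finite S" "j \<notin> S" "insert a D \<union> insert j T = insert j S"
    using insert by (auto simp: S_def)
  have sum: "(\<Sum>i\<in>S. hook_coeff a D (transpose j i \<circ> q \<circ> w)) = (1 + real (card T)) * hook_coeff a D (q \<circ> w)"
    if q: "q permutes S" for q
  proof -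
    have "inj (q \<circ> w)"
      using permutes_inj[OF q] insert by (simp add: inj_compose)
    then have "(\<Sum>i\<in>insert a D. hook_coeff a D (transpose j i \<circ> q \<circ> w)) = hook_coeff a D (q \<circ> w)"
      using hook_coeff_transversal[of D a j "q \<circ> w"] insert by (simp add: o_assoc)
    moreover have "hook_coeff a D (transpose j i \<circ> q \<circ> w) = hook_coeff a D (q \<circ> w)" if "i \<in> T" for i
      using hook_coeff_outside[of i a D j "q \<circ> w"] insert that by (auto simp: o_assoc)
    moreover have "(\<Sum>i\<in>S. hook_coeff a D (transpose j i \<circ> q \<circ> w)) =
       (\<Sum>i\<in>insert a D. hook_coeff a D (transpose j i \<circ> q \<circ> w)) + (\<Sum>i\<in>T. hook_coeff a D (transpose j i \<circ> q \<circ> w))"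
      unfolding S_def using insert by (intro sum.union_disjoint) auto
    ultimately show ?thesis
      by (simp add: algebra_simps)
  qed
  have "(\<Sum>\<pi> | \<pi> permutes insert j S. x ^ cycle_count (insert j S) \<pi> * hook_coeff a D (\<pi> \<circ> w)) =
    (\<Sum>q | q permutes S. (x + 1 + real (card T)) * (x ^ cycle_count S q * hook_coeff a D (q \<circ> w)))"
    by (subst sum_permutes_insert_cycles[OF S(1,2)])
       (auto intro!: sum.cong simp: sum algebra_simps simp flip: sum_distrib_left)
  also have "\<dots> = (x + 1 + real (card T)) *
      (pochhammer (x - real (card D)) (Suc (card D) + card T) * hook_coeff a D w)"
    using insert by (subst sum_distrib_left[symmetric]) (simp add: S_def comp_def)
  also have "\<dots> = pochhammer (x - real (card D)) (Suc (card D) + card (insert j T)) * hook_coeff a D w"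
    using insert by (simp add: pochhammer_Suc algebra_simps)
  finally show ?case
    unfolding S(3) .
qed

lemma cycle_sum_hook_coeff:
  fixes x :: real
  assumes U: "finite U" "a \<in> U" "D \<subseteq> U - {a}" and w: "w permutes U"
  shows "(\<Sum>\<pi> | \<pi> permutes U. x ^ cycle_count U \<pi> * hook_coeff a D (\<pi> \<circ> w)) =
     pochhammer (x - real (card D)) (card U) * hook_coeff a D w"
proof -
  have D: "finite D" "a \<notin> D" using U by (auto intro: finite_subset)
  have eq: "insert a D \<union> (U - insert a D) = U" using U by auto
  have "Suc (card D) + card (U - insert a D) = card U"
    using U D card_Un_disjoint[of "insert a D" "U - insert a D"] eq by simp
  moreover have "finite (U - insert a D)" "insert a D \<inter> (U - insert a D) = {}"
    using U by auto
  ultimately show ?thesis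
    using cycle_sum_hook_coeff_extend[of "U - insert a D" a D w x, unfolded eq] D permutes_inj[OF w]
    by simp
qed

section \<open>Alternating sums of hook coefficients\<close>

text \<open>This discards nearly all sets \<open>D\<close>: in a surviving one, an application of
  \<open>w\<close> can leave \<open>D\<close> only by hitting \<open>a\<close>.\<close>

lemma hook_coeff_eq_0:
  assumes "\<not> w ` D \<subseteq> insert a D"
  shows "hook_coeff a D w = 0"
proof -
  have "\<not> (u permutes insert a D \<and> (\<forall>d\<in>D. u d = w d))" for u
  proof
    assume u: "u permutes insert a D \<and> (\<forall>d\<in>D. u d = w d)"
    obtain d where d: "d \<in> D" "w d \<notin> insert a D"
      using assms by blast
    then show False
      using u permutes_in_image[of u "insert a D" d] by simp
  qed
  then have "{u. u permutes insert a D \<and> (\<forall>d\<in>D. u d = w d)} = {}"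
    by blast
  then show ?thesis
    by (simp only: hook_coeff_def sum.empty)
qed

lemma hook_coeff_empty: "hook_coeff a {} w = 1"
  by (simp add: hook_coeff_def)

text \<open>A contributing \<open>u\<close> for \<open>insert b D\<close> must hit \<open>b\<close>,
  and can do so only at \<open>a\<close>. Composing it with \<open>transpose a b\<close> on the
  right makes \<open>b\<close> a fixed point, and costs one sign. This lengthens a final segment of
  the cycle through \<open>a\<close> by one preceding point.\<close>

lemma hook_coeff_insert_preimage:
  assumes D: "finite D" "a \<notin> D" and b: "b \<notin> insert a D" and w: "inj w"
    and into: "w ` insert b D \<subseteq> insert a D"
  shows "hook_coeff a (insert b D) w = - hook_coeff a D w"
proof -
  let ?t = "transpose a b"
  have td: "?t d = d" if "d \<in> D" for d
    using that assms by (intro transpose_apply_other) auto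
  have t: "?t permutes insert a (insert b D)"
    by (intro permutes_swap_id) auto
  have "hook_coeff a (insert b D) w =
     (\<Sum>u | u permutes insert a D \<and> (\<forall>d\<in>D. u d = w d). of_int (- sign u))"
    unfolding hook_coeff_def
  proof (rule sum.reindex_bij_witness[of _ "\<lambda>u. u \<circ> ?t" "\<lambda>u. u \<circ> ?t"])
    fix u assume "u \<in> {u. u permutes insert a (insert b D) \<and> (\<forall>d\<in>insert b D. u d = w d)}"
    then have u: "u permutes insert a (insert b D)" "\<And>d. d \<in> insert b D \<Longrightarrow> u d = w d"
      by auto
    show "of_int (- sign (u \<circ> ?t)) = (of_int (sign u) :: real)"
      using sign_transpose_compose(2)[OF _ u(1), of a b] D b by fastforce
    have "b \<in> u ` insert a (insert b D)"
      using permutes_image[OF u(1)] by simp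
    moreover have "b \<notin> u ` insert b D"
      using u(2) into b by auto
    ultimately have ua: "u a = b"
      by auto
    have "u \<circ> ?t permutes insert a D"
    proof (rule permutes_superset)
      show "u \<circ> ?t permutes insert a (insert b D)"
        by (rule permutes_compose[OF t u(1)])
    qed (use ua b in auto)
    then show "u \<circ> ?t \<in> {u. u permutes insert a D \<and> (\<forall>d\<in>D. u d = w d)}"
      using u(2) td by simp
  next
    fix u assume "u \<in> {u. u permutes insert a D \<and> (\<forall>d\<in>D. u d = w d)}"
    then have u: "u permutes insert a D" "\<And>d. d \<in> D \<Longrightarrow> u d = w d"
      by auto
    have "w b \<in> u ` insert a D"
      using permutes_image[OF u(1)] into by auto
    moreover have "w b \<notin> u ` D"
      using u(2) w b by (auto dest: injD)
    ultimately have "u a = w b"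
      by auto
    moreover have "u permutes insert a (insert b D)"
      by (rule permutes_subset[OF u(1)]) auto
    ultimately show "u \<circ> ?t \<in> {u. u permutes insert a (insert b D) \<and> (\<forall>d\<in>insert b D. u d = w d)}"
      using permutes_compose[OF t] u(2) td by simp
  qed (simp_all flip: o_assoc)
  then show ?thesis
    by (simp add: hook_coeff_def sum_negf)
qed

text \<open>On a whole cycle \<open>C\<close> of \<open>w\<close>, \<open>u\<close> must coincide
  with \<open>w\<close>. Cancelling this cycle, the permutation \<open>r\<close> below, on the right
  leaves a permutation of \<open>insert a D\<close> and accounts for the sign of a cycle of length
  \<open>card C\<close>.\<close>

lemma hook_coeff_Un_orbit:
  assumes w: "permutation w" and D: "finite D" "D \<inter> orbit w z = {}" "a \<notin> orbit w z"
  shows "hook_coeff a (D \<union> orbit w z) w = (-1) ^ (card (orbit w z) - 1) * hook_coeff a D w"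
proof -
  define C where "C = orbit w z"
  define r where "r = perm_restrict w C"
  have z: "z \<in> C"
    unfolding C_def by (rule permutation_self_in_orbit[OF w])
  have C: "finite C"
    unfolding C_def by (rule finite_orbit[OF permutation_self_in_orbit[OF w]])
  have cyc: "cyclic_on w C"
    unfolding C_def by (rule cyclic_on_orbit'[OF w])
  have rC: "r x = w x" "w x \<in> C" if "x \<in> C" for x
    using that cyclic_on_inI[OF cyc that] by (auto simp: r_def perm_restrict_def)
  have rnC: "r x = x" if "x \<notin> C" for x
    using that by (simp add: r_def perm_restrict_def)
  have inj: "inj w"
    using w by (simp add: permutation_bijective bij_is_inj)
  have r: "r permutes C"
  proof (rule bij_imp_permutes)
    have "inj_on r C"
      using inj by (auto simp: inj_on_def rC)
    moreover have "r ` C \<subseteq> C"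
      using rC by auto
    ultimately show "bij_betw r C C"
      using endo_inj_surj[OF C] by (auto simp: bij_betw_def)
  qed (simp add: rnC)
  have "orbit r z = C"
    unfolding C_def
    by (rule orbit_cong[OF permutation_self_in_orbit[OF w]]) (use rC in \<open>simp add: C_def\<close>)
  then have sr: "sign r = (-1) ^ (card C - 1)"
    by (rule sign_single_orbit[OF C r z])
  have rperm: "permutation r"
    by (rule permutes_imp_permutation[OF C r])
  have r': "r permutes insert a (D \<union> C)" "inv r permutes insert a (D \<union> C)"
    using permutes_subset[OF r, of "insert a (D \<union> C)"] permutes_inv by auto
  have disj: "D \<inter> C = {}" "a \<notin> C"
    using D by (auto simp: C_def)
  have inv: "inv r x \<in> C" if "x \<in> C" for x
    using permutes_in_image[OF permutes_inv[OF r]] that by simp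
  have inv': "inv r x = x" if "x \<notin> C" for x
    using permutes_not_in[OF permutes_inv[OF r]] that by simp
  have "hook_coeff a (D \<union> C) w =
     (\<Sum>u | u permutes insert a D \<and> (\<forall>d\<in>D. u d = w d). (-1) ^ (card C - 1) * of_int (sign u))"
    unfolding hook_coeff_def
  proof (rule sum.reindex_bij_witness[of _ "\<lambda>u. u \<circ> r" "\<lambda>u. u \<circ> inv r"])
    fix u assume "u \<in> {u. u permutes insert a (D \<union> C) \<and> (\<forall>d\<in>D \<union> C. u d = w d)}"
    then have u: "u permutes insert a (D \<union> C)" "\<And>d. d \<in> D \<union> C \<Longrightarrow> u d = w d"
      by auto
    show "u \<circ> inv r \<circ> r = u"
      using permutes_inv_o[OF r] by (simp flip: o_assoc)
    have "permutation u"
      using permutes_imp_permutation[OF _ u(1)] D C by simp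
    then have "sign (u \<circ> inv r) = sign u * (-1) ^ (card C - 1)"
      using rperm sr by (simp add: sign_compose permutation_inverse sign_inverse)
    then show "(-1) ^ (card C - 1) * of_int (sign (u \<circ> inv r)) = (of_int (sign u) :: real)"
      by (simp flip: power_mult_distrib)
    have "u \<circ> inv r permutes insert a D"
    proof (rule permutes_superset)
      show "u \<circ> inv r permutes insert a (D \<union> C)"
        by (rule permutes_compose[OF r'(2) u(1)])
    next
      fix x assume "x \<in> insert a (D \<union> C) - insert a D"
      then have "x \<in> C" by auto
      then have "u (inv r x) = r (inv r x)"
        using inv u(2) rC by simp
      then show "(u \<circ> inv r) x = x"
        using permutes_inverses[OF r] by simp
    qed
    moreover have "inv r d = d" if "d \<in> D" for d
      using inv' that disj by auto
    ultimately show "u \<circ> inv r \<in> {u. u permutes insert a D \<and> (\<forall>d\<in>D. u d = w d)}"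
      using u(2) by simp
  next
    fix u assume "u \<in> {u. u permutes insert a D \<and> (\<forall>d\<in>D. u d = w d)}"
    then have u: "u permutes insert a D" "\<And>d. d \<in> D \<Longrightarrow> u d = w d"
      by auto
    show "u \<circ> r \<circ> inv r = u"
      using permutes_inv_o[OF r] by (simp flip: o_assoc)
    have "u permutes insert a (D \<union> C)"
      by (rule permutes_subset[OF u(1)]) auto
    then have "u \<circ> r permutes insert a (D \<union> C)"
      by (rule permutes_compose[OF r'(1)])
    moreover have "(u \<circ> r) d = w d" if "d \<in> D" for d
    proof -
      have "d \<notin> C" using that disj by auto
      then show ?thesis using u(2)[OF that] rnC by simp
    qed
    moreover have "(u \<circ> r) d = w d" if "d \<in> C" for d
    proof -
      have "w d \<notin> insert a D" using rC(2)[OF that] disj by auto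
      then show ?thesis using permutes_not_in[OF u(1)] rC(1)[OF that] by simp
    qed
    ultimately show "u \<circ> r \<in> {u. u permutes insert a (D \<union> C) \<and> (\<forall>d\<in>D \<union> C. u d = w d)}"
      by blast
  qed
  then show ?thesis
    by (simp add: hook_coeff_def C_def sum_distrib_left)
qed

text \<open>The factor \<open>(-1) ^ card D\<close> is the character of the hook with column length
  \<open>card D + 1\<close> on a long cycle. The weight \<open>c\<close> stays general because
  removing a cycle from \<open>V\<close> replaces it by a difference.\<close>

definition hook_sum :: "'a \<Rightarrow> 'a set \<Rightarrow> ('a \<Rightarrow> 'a) \<Rightarrow> (nat \<Rightarrow> real) \<Rightarrow> real" where
  "hook_sum a V w c = (\<Sum>D\<in>Pow (V - {a}). (-1) ^ card D * hook_coeff a D w * c (card D))"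

text \<open>A set with nonzero coefficient contains either all or nothing of the new cycle C.
  Passing from D to D together with C multiplies the alternating sign by (-1)^|C| and the
  coefficient by (-1)^(|C| - 1), in total by -1; this yields the difference of weights.\<close>

lemma hook_sum_Un_orbit:
  assumes w: "permutation w" and V: "finite V" "a \<in> V" "w ` V \<subseteq> V" and z: "z \<notin> V"
  shows "hook_sum a (V \<union> orbit w z) w c = hook_sum a V w (\<lambda>k. c k - c (k + card (orbit w z)))"
proof -
  define C where "C = orbit w z"
  let ?f = "\<lambda>D. (-1) ^ card D * hook_coeff a D w * c (card D)"
  let ?P = "Pow (V - {a})"
  have zC: "z \<in> C"
    unfolding C_def by (rule permutation_self_in_orbit[OF w])
  have C: "finite C"
    unfolding C_def by (rule finite_orbit[OF permutation_self_in_orbit[OF w]])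
  have orb: "orbit w y = C" if "y \<in> C" for y
    using orbit_eq_iff[OF w, of z y] that by (simp add: C_def)
  have disj: "V \<inter> C = {}"
  proof (rule ccontr)
    assume "V \<inter> C \<noteq> {}"
    then obtain y where y: "y \<in> V" "y \<in> C" by blast
    have "x \<in> V" if "x \<in> orbit w y" for x
      using that by induction (use y V in auto)
    from this[of z] show False
      using zC z by (simp add: orb[OF y(2)])
  qed
  then have a: "a \<notin> C" using V by auto
  have inj: "inj_on (\<lambda>D. D \<union> C) ?P"
    using disj by (auto simp: inj_on_def)
  \<comment> \<open>As \<open>a\<close> is not on \<open>C\<close>, a surviving \<open>D\<close>
    that meets \<open>C\<close> is closed under \<open>w\<close> along \<open>C\<close> and so
    contains all of it.\<close>
  have vanish: "hook_coeff a D w = 0"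
    if "D \<in> Pow (V \<union> C - {a})" "D \<notin> ?P \<union> (\<lambda>D. D \<union> C) ` ?P" for D
  proof (rule ccontr)
    assume "hook_coeff a D w \<noteq> 0"
    then have cl: "w ` D \<subseteq> insert a D"
      using hook_coeff_eq_0[of w D a] by argo
    show False
    proof (cases "D \<inter> C = {}")
      case True
      then show False using that by auto
    next
      case False
      then obtain y where y: "y \<in> D" "y \<in> C" by blast
      have "x \<in> D" if "x \<in> orbit w y" for x
        using that
      proof induction
        case base
        have "w y \<in> C" using orb[OF y(2)] orbit.base[of w y] by simp
        then show ?case using cl y a by auto
      next
        case (step x)
        have "w x \<in> C" using orb[OF y(2)] orbit.step[OF step(1)] by simp
        then show ?case using cl step a by auto
      qed
      then have "C \<subseteq> D"
        using orb[OF y(2)] by auto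
      then have "D = (D - C) \<union> C" "D - C \<in> ?P"
        using that by auto
      then show False using that by blast
    qed
  qed
  have "hook_sum a (V \<union> C) w c = sum ?f (?P \<union> (\<lambda>D. D \<union> C) ` ?P)"
    unfolding hook_sum_def
    by (rule sum.mono_neutral_right) (use V C a vanish in auto)
  also have "\<dots> = sum ?f ?P + sum ?f ((\<lambda>D. D \<union> C) ` ?P)"
    by (rule sum.union_disjoint) (use V zC disj in auto)
  also have "sum ?f ((\<lambda>D. D \<union> C) ` ?P) = (\<Sum>D\<in>?P. ?f (D \<union> C))"
    using inj by (simp add: sum.reindex)
  also have "\<dots> = (\<Sum>D\<in>?P. - ((-1) ^ card D * hook_coeff a D w * c (card D + card C)))"
  proof (rule sum.cong)
    fix D assume D: "D \<in> ?P"
    have fin: "finite D" "D \<inter> C = {}"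
      using D V disj by (auto intro: finite_subset)
    have card: "card (D \<union> C) = card D + card C"
      using fin C by (simp add: card_Un_disjoint)
    have hc: "hook_coeff a (D \<union> C) w = (-1) ^ (card C - 1) * hook_coeff a D w"
      using hook_coeff_Un_orbit[OF w, of D z a] fin a by (simp add: C_def)
    have "card C > 0" using zC C by (auto simp: card_gt_0_iff)
    then obtain m where "card C = Suc m" by (cases "card C") auto
    then have "(-1) ^ card (D \<union> C) * (-1) ^ (card C - 1) = - ((-1) ^ card D :: real)"
      by (simp add: card power_add flip: power_mult_distrib)
    then show "?f (D \<union> C) = - ((-1) ^ card D * hook_coeff a D w * c (card D + card C))"
      unfolding hc by (simp add: card algebra_simps)
  qed simp
  also have "sum ?f ?P + \<dots> = hook_sum a V w (\<lambda>k. c k - c (k + card C))"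
    by (simp add: hook_sum_def sum.distrib[symmetric] algebra_simps)
  finally show ?thesis
    by (simp add: C_def)
qed

section \<open>Contribution of the cycle through a\<close>

lemma upward_closed_eq_interval:
  fixes K :: "nat set"
  assumes "K \<subseteq> {..<l}" and "\<And>k. k \<in> K \<Longrightarrow> Suc k < l \<Longrightarrow> Suc k \<in> K"
  shows "K = {l - card K..<l}"
proof (cases "K = {}")
  case True
  then show ?thesis by simp
next
  case False
  have fin: "finite K" using assms finite_subset by blast
  define m where "m = Min K"
  have m: "m \<in> K" "\<And>k. k \<in> K \<Longrightarrow> m \<le> k"
    using False fin by (auto simp: m_def)
  have "k \<in> K" if "m \<le> k" "k < l" for k
    using that by (induction k rule: dec_induct) (use m assms in auto)
  then have "K = {m..<l}"
    using m assms by auto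
  then show ?thesis
    using m(1) assms(1) by auto
qed

text \<open>For each size below the length of the cycle exactly one set survives: the last points
  before the return to \<open>a\<close>. Its coefficient is built up one point at a time by
  \<open>hook_coeff_insert_preimage\<close> and cancels the alternating sign.\<close>

lemma hook_sum_orbit:
  assumes w: "permutation w"
  shows "hook_sum a (orbit w a) w c = (\<Sum>i<card (orbit w a). c i)"
proof -
  define g where "g k = (w ^^ k) a" for k
  define l where "l = funpow_dist1 w a a"
  have self: "a \<in> orbit w a"
    by (rule permutation_self_in_orbit[OF w])
  have l: "l > 0" by (simp add: l_def)
  have gl: "g l = a"
    unfolding g_def l_def by (rule funpow_dist1_prop[OF self])
  have g0: "g 0 = a" and gS: "w (g k) = g (Suc k)" for k
    by (simp_all add: g_def)
  have orb: "orbit w a = g ` {..<l}"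
    using orbit_conv_funpow_dist1[OF self] by (simp add: g_def[abs_def] l_def lessThan_atLeast0)
  have inj: "inj_on g {..<l}"
    using inj_on_funpow_dist1[OF self] by (simp add: g_def[abs_def] l_def lessThan_atLeast0)
  have card: "card (orbit w a) = l"
    using inj by (simp add: orb card_image)
  have inj_w: "inj w"
    using w by (simp add: permutation_bijective bij_is_inj)
  \<comment> \<open>The last \<open>i\<close> points before the cycle returns to \<open>a\<close>.
    The size \<open>i = l\<close> is excluded, as it would include \<open>a\<close> itself.\<close>
  define T where "T i = g ` {l - i..<l}" for i
  have cT: "card (T i) = i" if "i < l" for i
    unfolding T_def using that by (subst card_image) (auto intro: inj_on_subset[OF inj])
  have aT: "a \<notin> T i" if "i < l" for i
    using inj_onD[OF inj, of 0] g0 that by (force simp: T_def)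
  have Tsub: "T i \<in> Pow (orbit w a - {a})" if "i < l" for i
    using aT[OF that] by (auto simp: T_def orb)
  have into: "w ` T i \<subseteq> insert a (T i)" for i
  proof
    fix y assume "y \<in> w ` T i"
    then obtain k where k: "y = g (Suc k)" "l - i \<le> k" "k < l"
      by (auto simp: T_def gS)
    show "y \<in> insert a (T i)"
    proof (cases "Suc k = l")
      case True
      then show ?thesis using k gl by simp
    next
      case False
      then show ?thesis using k by (auto simp: T_def)
    qed
  qed
  have hT: "hook_coeff a (T i) w = (-1) ^ i" if "i < l" for i
    using that
  proof (induction i)
    case 0
    then show ?case by (simp add: T_def hook_coeff_empty)
  next
    case (Suc i)
    define b where "b = g (l - Suc i)"
    have S: "{l - Suc i..<l} = insert (l - Suc i) {l - i..<l}"
      using Suc.prems by auto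
    have TS: "T (Suc i) = insert b (T i)"
      unfolding T_def S b_def by simp
    have b: "b \<notin> insert a (T i)"
    proof
      assume "b \<in> insert a (T i)"
      moreover have "b \<noteq> a"
        using aT[OF Suc.prems] TS by auto
      \<comment> \<open>Otherwise \<open>T (Suc i)\<close> and \<open>T i\<close> would coincide,
        against their cardinalities.\<close>
      moreover have "b \<notin> T i"
        using cT[OF Suc.prems] cT[of i] Suc.prems TS by (auto simp: insert_absorb)
      ultimately show False by simp
    qed
    have "w b = g (l - i)"
      using Suc.prems by (simp add: b_def gS Suc_diff_Suc)
    moreover have "g (l - i) \<in> insert a (T i)"
      by (cases "i = 0") (use gl l in \<open>auto simp: T_def\<close>)
    ultimately have "w ` insert b (T i) \<subseteq> insert a (T i)"
      using into by auto
    then have "hook_coeff a (insert b (T i)) w = - hook_coeff a (T i) w"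
      using hook_coeff_insert_preimage[of "T i" a b w] aT[of i] b inj_w Suc.prems by (simp add: T_def)
    then show ?case
      using Suc TS by simp
  qed
  have vanish: "hook_coeff a D w = 0" if D: "D \<in> Pow (orbit w a - {a})" "D \<notin> T ` {..<l}" for D
  proof (rule ccontr)
    assume "hook_coeff a D w \<noteq> 0"
    then have cl: "w ` D \<subseteq> insert a D"
      using hook_coeff_eq_0[of w D a] by argo
    \<comment> \<open>In terms of exponents, the condition on the image of \<open>D\<close> says
      that \<open>K\<close> is closed under successors below \<open>l\<close>, hence a final
      segment.\<close>
    define K where "K = {k. k < l \<and> g k \<in> D}"
    have DK: "D = g ` K"
      using D orb by (auto simp: K_def)
    have 0: "0 \<notin> K"
      using D g0 by (auto simp: K_def)
    have "K = {l - card K..<l}"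
    proof (rule upward_closed_eq_interval)
      fix k assume k: "k \<in> K" "Suc k < l"
      then have "g (Suc k) \<in> insert a D"
        using cl gS[of k] by (auto simp: K_def)
      moreover have "g (Suc k) \<noteq> a"
        using inj_onD[OF inj, of "Suc k" 0] g0 k by auto
      ultimately show "Suc k \<in> K"
        using k by (simp add: K_def)
    qed (auto simp: K_def)
    moreover have "card K < l"
    proof -
      have "K \<subseteq> {1..<l}"
        using 0 by (auto simp: K_def Suc_le_eq intro!: Nat.gr0I)
      then have "card K \<le> card {1..<l}"
        by (intro card_mono) auto
      then show ?thesis using l by simp
    qed
    ultimately have "D = T (card K)" "card K \<in> {..<l}"
      using DK by (auto simp: T_def)
    then show False
      using D by blast
  qed
  have injT: "inj_on T {..<l}"
    by (rule inj_onI) (metis cT lessThan_iff)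
  have fin: "finite (orbit w a)"
    by (rule finite_orbit[OF self])
  have "hook_sum a (orbit w a) w c = (\<Sum>D\<in>T ` {..<l}. (-1) ^ card D * hook_coeff a D w * c (card D))"
    unfolding hook_sum_def
    by (rule sum.mono_neutral_right) (use fin vanish Tsub in auto)
  also have "\<dots> = (\<Sum>i<l. (-1) ^ card (T i) * hook_coeff a (T i) w * c (card (T i)))"
    using injT by (simp add: sum.reindex)
  also have "\<dots> = (\<Sum>i<l. c i)"
    by (rule sum.cong) (simp_all add: cT hT flip: power_mult_distrib)
  finally show ?thesis
    by (simp add: card)
qed

section \<open>Long cycles\<close>

lemma orbit_conjugate:
  assumes g: "g permutes S" and q: "q permutes S" "finite S"
  shows "orbit (g \<circ> q \<circ> inv g) (g x) = g ` orbit q x"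
  using orbit_inverse[of x q "g \<circ> q \<circ> inv g" g] permutes_inverses[OF g]
    permutation_self_in_orbit[OF permutes_imp_permutation[OF q(2,1)], of x] by simp

lemma orbits_conjugate:
  assumes g: "g permutes S" and q: "q permutes S" "finite S"
  shows "orbit (g \<circ> q \<circ> inv g) ` S = (`) g ` orbit q ` S"
proof -
  have "orbit (g \<circ> q \<circ> inv g) ` S = orbit (g \<circ> q \<circ> inv g) ` g ` S"
    by (simp only: permutes_image[OF g])
  also have "\<dots> = (`) g ` orbit q ` S"
    unfolding image_image by (rule image_cong) (simp_all only: orbit_conjugate[OF assms])
  finally show ?thesis .
qed

lemma cycle_count_conjugate:
  assumes "g permutes S" and "q permutes S" "finite S"
  shows "cycle_count S (g \<circ> q \<circ> inv g) = cycle_count S q"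
  unfolding cycle_count_def orbits_conjugate[OF assms]
  by (rule card_image) (use permutes_inj[OF assms(1)] in \<open>auto simp: inj_on_def inj_image_eq_iff\<close>)

text \<open>Any cycle that avoids \<open>a\<close> turns the constant weight 1 into 1 - 1 = 0. This
  is the expansion of the indicator of long cycles into hooks.\<close>

lemma hook_sum_const:
  assumes U: "finite U" "a \<in> U" and w: "w permutes U"
  shows "hook_sum a U w (\<lambda>_. 1) = (if orbit w a = U then real (card U) else 0)"
proof (cases "orbit w a = U")
  case True
  then show ?thesis
    using hook_sum_orbit[OF permutes_imp_permutation[OF U(1) w], of a "\<lambda>_. 1"] by simp
next
  case False
  have p: "permutation w" by (rule permutes_imp_permutation[OF U(1) w])
  have "orbit w a \<subseteq> U" using permutes_orbit_subset[OF w U(2)] .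
  with False obtain z where z: "z \<in> U" "z \<notin> orbit w a" by blast
  define V where "V = U - orbit w z"
  have "orbit w z \<subseteq> U" using permutes_orbit_subset[OF w z(1)] .
  then have eq: "V \<union> orbit w z = U" by (auto simp: V_def)
  have "w y \<in> V" if "y \<in> V" for y
  proof -
    have "w y \<notin> orbit w z"
      using cyclic_on_f_in[OF w cyclic_on_orbit'[OF p, of z], of y] that by (auto simp: V_def)
    then show ?thesis
      using that permutes_in_image[OF w] by (auto simp: V_def)
  qed
  moreover have "a \<in> V"
    using U z(2) orbit_eq_iff[OF p] permutation_self_in_orbit[OF p] by (auto simp: V_def)
  moreover have "z \<notin> V"
    using permutation_self_in_orbit[OF p] by (simp add: V_def)
  moreover have "finite V" using U by (simp add: V_def)
  ultimately have "hook_sum a (V \<union> orbit w z) w (\<lambda>_. 1) = hook_sum a V w (\<lambda>k. 1 - 1)"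
    using hook_sum_Un_orbit[OF p, of V a z] by blast
  then show ?thesis
    using False by (simp add: eq hook_sum_def)
qed

definition long_cycles :: "'a set \<Rightarrow> ('a \<Rightarrow> 'a) set" where
  "long_cycles U = {w. w permutes U \<and> cyclic_on w U}"

lemma long_cycles_eq:
  assumes "a \<in> U"
  shows "long_cycles U = {w. w permutes U \<and> orbit w a = U}"
  using assms by (auto simp: long_cycles_def orbit_cyclic_eq3 intro: cyclic_on_singleI)

text \<open>\<open>hook_sum_const\<close> turns the sum over long cycles into one over all
  permutations. Writing these as \<open>\<pi> \<circ> w\<close> makes it a convolution, and each
  hook coefficient is an eigenvector by \<open>cycle_sum_hook_coeff\<close>.\<close>

lemma long_cycle_sum_eq_hook_sum:
  fixes x :: real
  assumes U: "finite U" "a \<in> U" and w: "w permutes U"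
  shows "real (card U) * (\<Sum>\<omega>\<in>long_cycles U. x ^ cycle_count U (inv w \<circ> \<omega>)) =
    hook_sum a U w (\<lambda>k. pochhammer (x - real k) (card U))"
proof -
  let ?S = "{\<pi>. \<pi> permutes U}"
  have fin: "finite ?S" using U by (simp add: finite_permutations)
  \<comment> \<open>Conjugation by \<open>w\<close> moves \<open>inv w\<close> to the right, so that
    the substitution below multiplies \<open>w\<close> from the left, as the eigenvector lemma
    requires.\<close>
  have conj: "cycle_count U (inv w \<circ> \<omega>) = cycle_count U (\<omega> \<circ> inv w)" if "\<omega> permutes U" for \<omega>
  proof -
    have p: "inv w \<circ> \<omega> permutes U"
      using permutes_compose[OF that permutes_inv[OF w]] .
    have "w \<circ> (inv w \<circ> \<omega>) \<circ> inv w = \<omega> \<circ> inv w"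
      using permutes_inv_o[OF w] by (simp add: o_assoc)
    then show ?thesis
      using cycle_count_conjugate[OF w p U(1)] by simp
  qed
  have "real (card U) * (\<Sum>\<omega>\<in>long_cycles U. x ^ cycle_count U (inv w \<circ> \<omega>)) =
     (\<Sum>\<omega>\<in>?S. x ^ cycle_count U (\<omega> \<circ> inv w) * hook_sum a U \<omega> (\<lambda>_. 1))"
  proof -
    have "(\<Sum>\<omega>\<in>?S. x ^ cycle_count U (\<omega> \<circ> inv w) * hook_sum a U \<omega> (\<lambda>_. 1)) =
       (\<Sum>\<omega>\<in>?S. if orbit \<omega> a = U then real (card U) * x ^ cycle_count U (inv w \<circ> \<omega>) else 0)"
      by (rule sum.cong) (simp_all add: hook_sum_const[OF U] conj)
    also have "\<dots> = (\<Sum>\<omega>\<in>long_cycles U. real (card U) * x ^ cycle_count U (inv w \<circ> \<omega>))"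
      using fin by (simp add: sum.If_cases long_cycles_eq[OF U(2)] Collect_conj_eq)
    finally show ?thesis by (simp add: sum_distrib_left)
  qed
  also have "\<dots> = (\<Sum>\<pi>\<in>?S. x ^ cycle_count U \<pi> * hook_sum a U (\<pi> \<circ> w) (\<lambda>_. 1))"
  proof (rule sum.reindex_bij_witness[of _ "\<lambda>\<pi>. \<pi> \<circ> w" "\<lambda>\<omega>. \<omega> \<circ> inv w"])
    fix \<pi> assume "\<pi> \<in> ?S"
    then show "\<pi> \<circ> w \<in> ?S" "\<pi> \<circ> inv w \<in> ?S"
      using permutes_compose[OF w] permutes_compose[OF permutes_inv[OF w]] by auto
  qed (use permutes_inv_o[OF w] in \<open>simp_all flip: o_assoc\<close>)
  also have "\<dots> = (\<Sum>D\<in>Pow (U - {a}). (-1) ^ card D *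
      (\<Sum>\<pi>\<in>?S. x ^ cycle_count U \<pi> * hook_coeff a D (\<pi> \<circ> w)))"
    unfolding hook_sum_def sum_distrib_left by (subst sum.swap) (simp add: mult.left_commute)
  also have "\<dots> = hook_sum a U w (\<lambda>k. pochhammer (x - real k) (card U))"
    unfolding hook_sum_def
    by (rule sum.cong) (use cycle_sum_hook_coeff[OF U _ w] in simp_all)
  finally show ?thesis .
qed

text \<open>Both products share the factors of \<open>pochhammer y m\<close>; the remaining factors
  y + m and y - 1 differ by m + 1.\<close>

lemma pochhammer_backward_difference:
  fixes y :: real
  shows "pochhammer y (Suc m) - pochhammer (y - 1) (Suc m) = real (Suc m) * pochhammer y m"
  using pochhammer_rec[of "y - 1" m] by (simp add: pochhammer_Suc algebra_simps)

text \<open>A fixed point is a cycle of length 1, so it takes a backward difference of the weight: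
  the rising factorial drops one degree and its old degree comes out as a factor.\<close>

lemma hook_sum_Un_fixed_points:
  fixes x :: real
  assumes w: "permutation w" and V: "finite V" "a \<in> V" "w ` V \<subseteq> V"
    and F: "finite F" "F \<inter> V = {}" "\<And>f. f \<in> F \<Longrightarrow> w f = f"
  shows "hook_sum a (V \<union> F) w (\<lambda>k. pochhammer (x - real k) (m + card F)) =
    fact (m + card F) / fact m * hook_sum a V w (\<lambda>k. pochhammer (x - real k) m)"
  using F
proof (induction F rule: finite_induct)
  case empty
  then show ?case by simp
next
  case (insert f F)
  let ?m = "m + card F"
  have f: "orbit w f = {f}"
    using insert.prems by (simp add: orbit_eq_singleton_iff)
  have "w ` (V \<union> F) \<subseteq> V \<union> F"
    using V insert.prems by auto
  then have "hook_sum a ((V \<union> F) \<union> orbit w f) w (\<lambda>k. pochhammer (x - real k) (Suc ?m)) =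
    hook_sum a (V \<union> F) w (\<lambda>k. pochhammer (x - real k) (Suc ?m) - pochhammer (x - real (k + card (orbit w f))) (Suc ?m))"
    using V insert by (intro hook_sum_Un_orbit[OF w]) auto
  also have "(\<lambda>k. pochhammer (x - real k) (Suc ?m) - pochhammer (x - real (k + card (orbit w f))) (Suc ?m)) =
     (\<lambda>k. real (Suc ?m) * pochhammer (x - real k) ?m)"
    using pochhammer_backward_difference[of "x - real _" ?m] by (simp add: f fun_eq_iff algebra_simps)
  also have "hook_sum a (V \<union> F) w \<dots> = real (Suc ?m) * hook_sum a (V \<union> F) w (\<lambda>k. pochhammer (x - real k) ?m)"
    by (simp add: hook_sum_def sum_distrib_left mult_ac)
  finally show ?case
    using insert by (simp add: f)
qed

lemma card_long_cycles:
  assumes U: "finite U" "U \<noteq> {}"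
  shows "card (long_cycles U) = fact (card U - 1)"
proof -
  \<comment> \<open>The case w = id and x = 1 of the general sum.\<close>
  obtain a where a: "a \<in> U" using U by auto
  have perm: "permutation (id :: 'a \<Rightarrow> 'a)"
    by simp
  have orb: "orbit id a = {a}" by (simp add: orbit_eq_singleton_iff)
  have "cycle_count U \<omega> = 1" if "\<omega> \<in> long_cycles U" for \<omega>
  proof -
    have "orbit \<omega> ` U = {U}"
      using that a orbit_cyclic_eq3[of \<omega> U] by (auto simp: long_cycles_def image_def)
    then show ?thesis by (simp add: cycle_count_def)
  qed
  then have "real (card U) * real (card (long_cycles U)) =
      hook_sum a U id (\<lambda>k. pochhammer (1 - real k) (card U))"
    using long_cycle_sum_eq_hook_sum[OF U(1) a permutes_id, of 1] by simp
  also have "\<dots> = hook_sum a ({a} \<union> (U - {a})) id (\<lambda>k. pochhammer (1 - real k) (1 + card (U - {a})))"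
  proof -
    have "{a} \<union> (U - {a}) = U" "1 + card (U - {a}) = card U"
      using a U card.remove[of U a] by auto
    then show ?thesis by simp
  qed
  also have "\<dots> = fact (1 + card (U - {a})) / fact 1 * hook_sum a {a} id (\<lambda>k. pochhammer (1 - real k) 1)"
    by (rule hook_sum_Un_fixed_points[OF perm]) (use U in auto)
  \<comment> \<open>Only the empty set \<open>D\<close> remains; both its coefficient and its weight
    are 1.\<close>
  also have "hook_sum a {a} id (\<lambda>k. pochhammer (1 - real k) 1) = 1"
    by (simp add: hook_sum_def hook_coeff_empty)
  also have "1 + card (U - {a}) = card U"
    using a U card.remove[of U a] by simp
  finally have "real (card U * card (long_cycles U)) = real (fact (card U))"
    by simp
  then have "card U * card (long_cycles U) = fact (card U)"
    by (simp only: of_nat_eq_iff)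
  moreover have "card U > 0" using U by (simp add: card_gt_0_iff)
  ultimately show ?thesis
    using fact_reduce[of "card U", where 'a = nat] by simp
qed

text \<open>The fixed points are removed first and lower the degree to p + r. The cycle of
  \<open>z\<close> then gives one difference with step r, and the cycle of \<open>a\<close> a sum
  over its p possible sizes.\<close>

lemma long_cycle_sum_two_cycles:
  fixes x :: real
  assumes U: "finite U" "a \<in> U" "z \<in> U" and w: "w permutes U" and z: "z \<notin> orbit w a"
    and fixed: "\<And>f. f \<in> U - (orbit w a \<union> orbit w z) \<Longrightarrow> w f = f"
    and p: "card (orbit w a) = p" and r: "card (orbit w z) = r"
  shows "(\<Sum>\<omega>\<in>long_cycles U. x ^ cycle_count U (inv w \<circ> \<omega>)) =
    fact (card U - 1) / fact (p + r) *
      (\<Sum>i<p. pochhammer (x - real i) (p + r) - pochhammer (x - real (i + r)) (p + r))"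
proof -
  define V where "V = orbit w a \<union> orbit w z"
  have perm: "permutation w" by (rule permutes_imp_permutation[OF U(1) w])
  have a: "a \<in> orbit w a" by (rule permutation_self_in_orbit[OF perm])
  have sub: "V \<subseteq> U"
    using permutes_orbit_subset[OF w] U by (simp add: V_def)
  have finV: "finite V" "finite (orbit w a)"
    using sub U finite_subset by (auto simp: V_def)
  have "orbit w a \<inter> orbit w z = {}"
  proof (rule ccontr)
    assume "orbit w a \<inter> orbit w z \<noteq> {}"
    then obtain y where "y \<in> orbit w a" "y \<in> orbit w z" by blast
    then have "orbit w a = orbit w z"
      using orbit_eq_iff[OF perm] by metis
    then show False
      using z permutation_self_in_orbit[OF perm] by blast
  qed
  then have cardV: "card V = p + r"
    using finV p r by (simp add: V_def card_Un_disjoint)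
  have closed: "w ` orbit w y \<subseteq> orbit w y" for y
    by (auto intro: orbit.step)
  have card: "p + r + card (U - V) = card U"
    using card_Diff_subset[OF finV(1) sub] card_mono[OF U(1) sub] cardV by simp
  have "real (card U) * (\<Sum>\<omega>\<in>long_cycles U. x ^ cycle_count U (inv w \<circ> \<omega>)) =
     hook_sum a (V \<union> (U - V)) w (\<lambda>k. pochhammer (x - real k) (p + r + card (U - V)))"
    unfolding card using long_cycle_sum_eq_hook_sum[OF U(1,2) w] sub by (simp add: Un_absorb1)
  also have "\<dots> = fact (p + r + card (U - V)) / fact (p + r) * hook_sum a V w (\<lambda>k. pochhammer (x - real k) (p + r))"
    by (rule hook_sum_Un_fixed_points[OF perm finV(1)])
       (use a closed[of a] closed[of z] U fixed in \<open>auto simp: V_def\<close>)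
  also have "hook_sum a V w (\<lambda>k. pochhammer (x - real k) (p + r)) =
     hook_sum a (orbit w a) w (\<lambda>k. pochhammer (x - real k) (p + r) - pochhammer (x - real (k + card (orbit w z))) (p + r))"
    unfolding V_def by (rule hook_sum_Un_orbit[OF perm finV(2) a closed z])
  also have "\<dots> = (\<Sum>i<p. pochhammer (x - real i) (p + r) - pochhammer (x - real (i + r)) (p + r))"
    by (simp add: hook_sum_orbit[OF perm] p r)
  finally have "real (card U) * (\<Sum>\<omega>\<in>long_cycles U. x ^ cycle_count U (inv w \<circ> \<omega>)) =
     fact (card U) / fact (p + r) *
      (\<Sum>i<p. pochhammer (x - real i) (p + r) - pochhammer (x - real (i + r)) (p + r))"
    unfolding card .
  moreover have "card U > 0" using U by (auto simp: card_gt_0_iff)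
  moreover have "(fact (card U) :: real) = real (card U) * fact (card U - 1)"
    using \<open>card U > 0\<close> by (simp add: fact_reduce)
  ultimately show ?thesis
    by (simp add: field_simps)
qed

section \<open>Binomial and Stirling identities\<close>

lemma sum_gbinomial_shift:
  fixes x :: real
  shows "(\<Sum>i<p. (x + real i) gchoose N) = ((x + real p) gchoose Suc N) - (x gchoose Suc N)"
proof (induction p)
  case (Suc p)
  then show ?case
    using gbinomial_Suc_Suc[of "x + real p" N] by (simp add: add_ac)
qed simp

text \<open>This is Vandermonde's identity for lower index N + 1 without its two end terms. The one
  at j = 0 vanishes because p < N + 1; the one at j = N + 1 is what the telescoping sum
  subtracts.\<close>

lemma vandermonde_truncated:
  fixes x :: real
  assumes "p \<le> N"
  shows "(\<Sum>j=1..N. real (p choose (N + 1 - j)) * (x gchoose j)) = (\<Sum>i<p. (x + real i) gchoose N)"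
proof -
  have "(\<Sum>k=0..Suc N. (x gchoose k) * (real p gchoose (Suc N - k))) = ((x + real p) gchoose Suc N)"
    by (rule gbinomial_Vandermonde)
  moreover have "(\<Sum>k=0..Suc N. (x gchoose k) * (real p gchoose (Suc N - k))) =
     (real p gchoose Suc N) + (\<Sum>j=1..N. (x gchoose j) * (real p gchoose (Suc N - j))) + (x gchoose Suc N)"
    by (simp add: sum.atLeast_Suc_atMost[of 0])
  moreover have "(real p gchoose Suc N) = 0"
    using assms by (simp add: binomial_gbinomial[symmetric])
  ultimately show ?thesis
    by (simp add: sum_gbinomial_shift binomial_gbinomial mult.commute)
qed

lemma sum_stirling_pochhammer:
  fixes x :: real
  assumes "j \<le> n"
  shows "(\<Sum>m\<le>n. real (stirling j m) * x ^ m) = pochhammer x j"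
proof -
  have "(\<Sum>m\<le>n. real (stirling j m) * x ^ m) = (\<Sum>m\<le>j. real (stirling j m) * x ^ m)"
    by (rule sum.mono_neutral_right) (use assms in auto)
  then show ?thesis
    by (simp add: stirling_pochhammer)
qed

text \<open>The claimed value of the quotient, with N in place of n - t. The exponent j + m has the
  parity of j - m and is never negative.\<close>

definition hook_weight :: "nat \<Rightarrow> nat \<Rightarrow> nat \<Rightarrow> real" where
  "hook_weight p N m = (\<Sum>j=1..N. ((-1) ^ (N - j) - (-1) ^ (j + m)) / fact j *
     real (p choose (N + 1 - j)) * real (stirling j m))"

text \<open>Both halves of the difference become the same binomial sum, one at -x and one at x.
  \<open>vandermonde_truncated\<close> turns these into sums over j, and Stirling numbers expand the
  result in powers of x; the powers of -x supply the sign depending on m.\<close>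

lemma pochhammer_difference_eq_hook_weight:
  fixes x :: real
  assumes "N = p + r" "r \<ge> 1" "N \<le> n"
  shows "(\<Sum>i<p. pochhammer (x - real i) N - pochhammer (x - real (i + r)) N) / fact N =
    (\<Sum>m\<le>n. hook_weight p N m * x ^ m)"
proof -
  have 1: "pochhammer (x - real i) N / fact N = (-1) ^ N * ((- x + real i) gchoose N)" for i
    by (simp add: gbinomial_pochhammer flip: power_mult_distrib)
  \<comment> \<open>The largest factor of the rising factorial is x - i - r + N - 1, which equals x
    + p - 1 - i because N = p + r.\<close>
  have 2: "pochhammer (x - real (i + r)) N / fact N = ((x + real (p - Suc i)) gchoose N)" if "i < p" for i
    using that assms by (simp add: gbinomial_pochhammer' of_nat_diff algebra_simps)
  have "(\<Sum>i<p. pochhammer (x - real i) N - pochhammer (x - real (i + r)) N) / fact N =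
     (-1) ^ N * (\<Sum>i<p. (- x + real i) gchoose N) - (\<Sum>i<p. (x + real (p - Suc i)) gchoose N)"
  proof -
    have "(\<Sum>i<p. pochhammer (x - real (i + r)) N / fact N) = (\<Sum>i<p. (x + real (p - Suc i)) gchoose N)"
      by (rule sum.cong) (simp_all only: 2 lessThan_iff)
    then show ?thesis
      by (simp only: sum_subtractf diff_divide_distrib sum_divide_distrib sum_distrib_left 1)
  qed
  also have "(\<Sum>i<p. (x + real (p - Suc i)) gchoose N) = (\<Sum>i<p. (x + real i) gchoose N)"
    by (rule sum.nat_diff_reindex)
  also have "(-1) ^ N * (\<Sum>i<p. (- x + real i) gchoose N) - (\<Sum>i<p. (x + real i) gchoose N) =
     (\<Sum>j=1..N. real (p choose (N + 1 - j)) * ((-1) ^ N * (- x gchoose j) - (x gchoose j)))"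
  proof -
    have "p \<le> N" using assms by simp
    then show ?thesis
      unfolding vandermonde_truncated[OF \<open>p \<le> N\<close>, symmetric] sum_distrib_left sum_subtractf[symmetric]
      by (intro sum.cong) (simp_all add: algebra_simps)
  qed
  \<comment> \<open>Reflection at each of -x and x: a binomial coefficient with upper argument y is
    (-1)^j times the rising factorial of -y, divided by j!.\<close>
  also have "\<dots> = (\<Sum>j=1..N. real (p choose (N + 1 - j)) *
      (((-1) ^ (N - j) * pochhammer x j - (-1) ^ j * pochhammer (- x) j) / fact j))"
  proof (rule sum.cong)
    fix j assume j: "j \<in> {1..N}"
    then have "(-1) ^ N = (-1) ^ (N - j) * ((-1) ^ j :: real)"
      by (simp flip: power_add)
    then show "real (p choose (N + 1 - j)) * ((-1) ^ N * (- x gchoose j) - (x gchoose j)) =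
      real (p choose (N + 1 - j)) * (((-1) ^ (N - j) * pochhammer x j - (-1) ^ j * pochhammer (- x) j) / fact j)"
      by (simp add: gbinomial_pochhammer diff_divide_distrib flip: power_mult_distrib)
  qed simp
  also have "\<dots> = (\<Sum>j=1..N. \<Sum>m\<le>n. ((-1) ^ (N - j) - (-1) ^ (j + m)) / fact j *
     real (p choose (N + 1 - j)) * real (stirling j m) * x ^ m)"
  proof (rule sum.cong)
    fix j assume j: "j \<in> {1..N}"
    have "(-1) ^ (N - j) * pochhammer x j - (-1) ^ j * pochhammer (- x) j =
       (\<Sum>m\<le>n. (-1) ^ (N - j) * (real (stirling j m) * x ^ m) - (-1) ^ j * (real (stirling j m) * (- x) ^ m))"
      unfolding sum_subtractf sum_distrib_left[symmetric]
      using j assms by (simp add: sum_stirling_pochhammer)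
    also have "\<dots> = (\<Sum>m\<le>n. ((-1) ^ (N - j) - (-1) ^ (j + m)) * real (stirling j m) * x ^ m)"
      by (rule sum.cong) (simp_all add: power_minus[of x] power_add algebra_simps)
    finally show "real (p choose (N + 1 - j)) *
        (((-1) ^ (N - j) * pochhammer x j - (-1) ^ j * pochhammer (- x) j) / fact j) =
      (\<Sum>m\<le>n. ((-1) ^ (N - j) - (-1) ^ (j + m)) / fact j *
        real (p choose (N + 1 - j)) * real (stirling j m) * x ^ m)"
      by (simp add: sum_distrib_left sum_divide_distrib mult_ac)
  qed simp
  also have "\<dots> = (\<Sum>m\<le>n. hook_weight p N m * x ^ m)"
    by (subst sum.swap) (simp add: hook_weight_def sum_distrib_right)
  finally show ?thesis .
qed

section \<open>Factorizations of the long cycle\<close>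

lemma orbit_eq_interval:
  fixes f :: "nat \<Rightarrow> nat"
  assumes "\<And>x. a \<le> x \<Longrightarrow> x < b \<Longrightarrow> f x = x + 1" "f b = a" "x \<in> {a..b}"
  shows "orbit f x = {a..b}"
proof -
  have up: "y \<in> orbit f x'" if "x' < y" "y \<le> b" "a \<le> x'" for x' y
    using that
  proof (induction y rule: less_induct)
    case (less y)
    then have y: "f (y - 1) = y" using assms(1)[of "y - 1"] by simp
    show ?case
    proof (cases "y - 1 = x'")
      case True
      then show ?thesis using y orbit.base[of f x'] by simp
    next
      case False
      then have "y - 1 \<in> orbit f x'" using less by simp
      then show ?thesis using y orbit.step[of "y - 1" f x'] by simp
    qed
  qed
  have b: "b \<in> orbit f x \<or> x = b"
    using up[of x b] assms(3) by auto
  have a: "a \<in> orbit f x"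
    using b orbit.step[of b f x] orbit.base[of f x] assms(2) by auto
  have "{a..b} \<subseteq> orbit f x"
  proof
    fix y assume y: "y \<in> {a..b}"
    show "y \<in> orbit f x"
    proof (cases "y = a")
      case True
      then show ?thesis using a by simp
    next
      case False
      then have "y \<in> orbit f a" using up[of a y] y by simp
      then show ?thesis using orbit_trans[OF _ a] by blast
    qed
  qed
  moreover have "y \<in> {a..b}" if "y \<in> orbit f x" for y
    using that
  proof induction
    case base
    show ?case using assms by (cases "x = b") auto
  next
    case (step y)
    then show ?case using assms by (cases "y = b") auto
  qed
  ultimately show ?thesis by blast
qed

lemma long_cycle_permutes: "long_cycle n permutes {1..n}"
proof (rule bij_imp_permutes)
  have "long_cycle n ` {1..n} \<subseteq> {1..n}" "inj_on (long_cycle n) {1..n}"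
    by (auto simp: long_cycle_def inj_on_def)
  then show "bij_betw (long_cycle n) {1..n} {1..n}"
    using endo_inj_surj[of "{1..n}"] by (auto simp: bij_betw_def)
qed (auto simp: long_cycle_def)

text \<open>Listing the cycle of \<open>w\<close> from 1 and sending k to the k-th entry of the list
  conjugates the standard cycle into \<open>w\<close>.\<close>

lemma long_cycle_conjugate:
  assumes n: "n \<ge> 1" and w: "w \<in> long_cycles {1..n}"
  obtains g where "g permutes {1..n}" "w = g \<circ> long_cycle n \<circ> inv g"
proof -
  have wp: "w permutes {1..n}" and cyc: "cyclic_on w {1..n}"
    using w by (auto simp: long_cycles_def)
  have orb: "orbit w 1 = {1..n}"
    by (rule orbit_cyclic_eq3[OF cyc]) (use n in simp)
  then have self: "1 \<in> orbit w 1" using n by simp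
  define h where "h k = (w ^^ k) 1" for k
  define l where "l = funpow_dist1 w 1 1"
  have inj: "inj_on h {0..<l}" and im: "h ` {0..<l} = {1..n}"
    using inj_on_funpow_dist1[OF self] orbit_conv_funpow_dist1[OF self] orb
    by (simp_all add: h_def[abs_def] l_def)
  have l: "l = n"
    using card_image[OF inj] im by simp
  have hl: "h n = 1"
    using funpow_dist1_prop[OF self] unfolding h_def l[symmetric] by (simp only: l_def)
  have wh: "w (h k) = h (Suc k)" for k
    by (simp add: h_def)
  \<comment> \<open>The shift by one is due to points starting at 1 and exponents at 0. The
    wrap-around at \<open>n\<close> is \<open>h n = 1\<close>.\<close>
  define g where "g x = (if x \<in> {1..n} then h (x - 1) else x)" for x
  have shift: "(\<lambda>x. x - 1) ` {1..n} = {0..<n}"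
  proof
    show "{0..<n} \<subseteq> (\<lambda>x. x - 1) ` {1..n}"
      by (auto intro!: image_eqI[of _ _ "Suc _"])
  qed auto
  have g: "g permutes {1..n}"
  proof (rule bij_imp_permutes)
    have "bij_betw (h \<circ> (\<lambda>x. x - 1)) {1..n} {1..n}"
      by (rule bij_betw_trans[of _ _ "{0..<n}"])
         (use inj im l shift in \<open>auto simp: bij_betw_def inj_on_def\<close>)
    then show "bij_betw g {1..n} {1..n}"
      by (rule bij_betw_cong[THEN iffD1, rotated]) (simp add: g_def)
  qed (auto simp: g_def)
  have "(g \<circ> long_cycle n) x = (w \<circ> g) x" for x
  proof (cases "x \<in> {1..n}")
    case True
    then have "w (g x) = h x"
      using wh[of "x - 1"] by (simp add: g_def)
    then show ?thesis
      using True n hl by (cases "x = n") (auto simp: g_def long_cycle_def h_def)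
  next
    case False
    then show ?thesis
      using permutes_not_in[OF wp False] by (simp add: g_def long_cycle_def del: atLeastAtMost_iff)
  qed
  then have "g \<circ> long_cycle n \<circ> inv g = w \<circ> (g \<circ> inv g)"
    by (simp add: fun_eq_iff)
  then have "w = g \<circ> long_cycle n \<circ> inv g"
    using permutes_inv_o[OF g] by simp
  with g show ?thesis using that by blast
qed

section \<open>From the standard long cycle to an arbitrary one\<close>

lemma num_cycles_eq: "num_cycles n f = cycle_count {1..n} f"
  unfolding num_cycles_def perm_cycles_def cycle_count_def by (rule refl)

lemma cycle_type_conjugate:
  assumes g: "g permutes {1..n}" and q: "q permutes {1..n}"
  shows "cycle_type n (g \<circ> q \<circ> inv g) = cycle_type n q"
proof -
  have "perm_cycles n (g \<circ> q \<circ> inv g) = (`) g ` perm_cycles n q"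
    using orbits_conjugate[OF g q] by (simp add: perm_cycles_def)
  moreover have "inj ((`) g)"
    using permutes_inj[OF g] by (simp add: inj_on_def inj_image_eq_iff)
  moreover have "card (g ` C) = card C" for C
    using permutes_inj[OF g] by (meson card_image inj_on_subset subset_UNIV)
  ultimately show ?thesis
    by (simp add: cycle_type_def image_mset_mset_set[symmetric] inj_on_subset
        multiset.map_comp comp_def)
qed

text \<open>In a factorization the second factor is determined by the first, and simultaneous
  conjugation carries the standard cycle to \<open>w\<close>. Hence the count is the same for every
  long cycle, which permits averaging over all of them.\<close>

lemma mu_eq_card_quotient:
  assumes n: "n \<ge> 1" and w: "w \<in> long_cycles {1..n}"
  shows "mu n m \<gamma> = card {\<sigma>. \<sigma> permutes {1..n} \<and> cycle_type n \<sigma> = \<gamma> \<and> cycle_count {1..n} (inv \<sigma> \<circ> w) = m}"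
proof -
  let ?c = "long_cycle n"
  let ?U = "{1..n}"
  obtain g where g: "g permutes ?U" "w = g \<circ> ?c \<circ> inv g"
    using long_cycle_conjugate[OF n w] .
  let ?A = "{(\<sigma>, \<pi>). \<sigma> permutes ?U \<and> \<pi> permutes ?U \<and>
      \<sigma> \<circ> \<pi> = ?c \<and> cycle_type n \<sigma> = \<gamma> \<and> num_cycles n \<pi> = m}"
  let ?B = "{\<sigma>. \<sigma> permutes ?U \<and> cycle_type n \<sigma> = \<gamma> \<and> cycle_count ?U (inv \<sigma> \<circ> ?c) = m}"
  let ?C = "{\<sigma>. \<sigma> permutes ?U \<and> cycle_type n \<sigma> = \<gamma> \<and> cycle_count ?U (inv \<sigma> \<circ> w) = m}"
  have fst: "bij_betw fst ?A ?B"
  proof (rule bij_betw_byWitness[where f' = "\<lambda>\<sigma>. (\<sigma>, inv \<sigma> \<circ> ?c)"])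
    have pi: "inv \<sigma> \<circ> ?c = \<pi>" if "\<sigma> permutes ?U" "\<sigma> \<circ> \<pi> = ?c" for \<sigma> \<pi>
    proof -
      have "inv \<sigma> \<circ> ?c = inv \<sigma> \<circ> \<sigma> \<circ> \<pi>"
        by (simp only: that(2) o_assoc[symmetric])
      then show ?thesis
        using permutes_inv_o(2)[OF that(1)] by simp
    qed
    show "\<forall>a\<in>?A. (fst a, inv (fst a) \<circ> ?c) = a" "fst ` ?A \<subseteq> ?B"
      using pi by (auto simp: num_cycles_eq)
    have "\<sigma> \<circ> (inv \<sigma> \<circ> ?c) = ?c" "inv \<sigma> \<circ> ?c permutes ?U" if "\<sigma> permutes ?U" for \<sigma>
      using permutes_inv_o[OF that] permutes_compose[OF long_cycle_permutes permutes_inv[OF that]]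
      by (simp_all add: o_assoc)
    then show "(\<lambda>\<sigma>. (\<sigma>, inv \<sigma> \<circ> ?c)) ` ?B \<subseteq> ?A"
      by (auto simp: num_cycles_eq)
  qed simp
  have conj: "bij_betw (\<lambda>\<sigma>. g \<circ> \<sigma> \<circ> inv g) ?B ?C"
  proof (rule bij_betw_byWitness[where f' = "\<lambda>\<sigma>. inv g \<circ> \<sigma> \<circ> g"])
    have gg: "inv g permutes ?U" "inv (inv g) = g"
      using permutes_inv[OF g(1)] permutes_inv_inv[OF g(1)] by auto
    show "\<forall>\<sigma>\<in>?B. inv g \<circ> (g \<circ> \<sigma> \<circ> inv g) \<circ> g = \<sigma>" "\<forall>\<sigma>\<in>?C. g \<circ> (inv g \<circ> \<sigma> \<circ> g) \<circ> inv g = \<sigma>"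
      using permutes_inverses[OF g(1)] by (auto simp: fun_eq_iff)
    have key: "cycle_count ?U (inv (g \<circ> \<sigma> \<circ> inv g) \<circ> w) = cycle_count ?U (inv \<sigma> \<circ> ?c)"
      if \<sigma>: "\<sigma> permutes ?U" for \<sigma>
    proof -
      have "inv (g \<circ> \<sigma> \<circ> inv g) = g \<circ> inv \<sigma> \<circ> inv g"
      proof (rule inv_unique_comp)
        show "g \<circ> \<sigma> \<circ> inv g \<circ> (g \<circ> inv \<sigma> \<circ> inv g) = id" "g \<circ> inv \<sigma> \<circ> inv g \<circ> (g \<circ> \<sigma> \<circ> inv g) = id"
          using permutes_inverses[OF g(1)] permutes_inverses[OF \<sigma>] by (auto simp: fun_eq_iff)
      qed
      then have "inv (g \<circ> \<sigma> \<circ> inv g) \<circ> w = g \<circ> (inv \<sigma> \<circ> ?c) \<circ> inv g"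
        using permutes_inverses[OF g(1)] by (auto simp: fun_eq_iff g(2))
      then show ?thesis
        using cycle_count_conjugate[OF g(1) permutes_compose[OF long_cycle_permutes permutes_inv[OF \<sigma>]]]
        by simp
    qed
    have pc: "g \<circ> \<sigma> \<circ> inv g permutes ?U" "inv g \<circ> \<sigma> \<circ> g permutes ?U" if "\<sigma> permutes ?U" for \<sigma>
      using that g(1) gg(1) by (auto intro!: permutes_compose)
    show "(\<lambda>\<sigma>. g \<circ> \<sigma> \<circ> inv g) ` ?B \<subseteq> ?C"
      using key pc cycle_type_conjugate[OF g(1)] by auto
    show "(\<lambda>\<sigma>. inv g \<circ> \<sigma> \<circ> g) ` ?C \<subseteq> ?B"
    proof
      fix \<tau> assume "\<tau> \<in> (\<lambda>\<sigma>. inv g \<circ> \<sigma> \<circ> g) ` ?C"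
      then obtain \<sigma> where \<sigma>: "\<sigma> \<in> ?C" "\<tau> = inv g \<circ> \<sigma> \<circ> g" by blast
      then have \<tau>: "\<tau> permutes ?U" using pc by blast
      have "g \<circ> \<tau> \<circ> inv g = \<sigma>"
        using permutes_inverses[OF g(1)] by (auto simp: fun_eq_iff \<sigma>(2))
      then show "\<tau> \<in> ?B"
        using \<sigma>(1) \<tau> key[OF \<tau>] cycle_type_conjugate[OF g(1) \<tau>] by simp
    qed
  qed
  show ?thesis
    by (simp only: mu_def bij_betw_same_card[OF fst] bij_betw_same_card[OF conj])
qed

text \<open>Taking one cycle of size p and one of size r out of the multiset leaves only ones, so
  all remaining points are fixed.\<close>

lemma cycle_type_two_cycles:
  assumes \<sigma>: "\<sigma> permutes {1..n}" and type: "cycle_type n \<sigma> = replicate_mset t 1 + {#p, r#}"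
  obtains a z where "a \<in> {1..n}" "z \<in> {1..n}" "z \<notin> orbit \<sigma> a"
    "card (orbit \<sigma> a) = p" "card (orbit \<sigma> z) = r"
    "\<forall>f\<in>{1..n} - (orbit \<sigma> a \<union> orbit \<sigma> z). \<sigma> f = f"
proof -
  let ?O = "perm_cycles n \<sigma>"
  have perm: "permutation \<sigma>"
    using permutes_imp_permutation[OF _ \<sigma>] by simp
  have fin: "finite ?O"
    by (simp add: perm_cycles_def)
  have type: "image_mset card (mset_set ?O) = replicate_mset t 1 + {#p, r#}"
    using type by (simp add: cycle_type_def)
  then have "p \<in># image_mset card (mset_set ?O)" by simp
  then obtain A where A: "A \<in> ?O" "card A = p"
    using fin by auto
  \<comment> \<open>\<open>A\<close> is removed before \<open>Z\<close> is chosen, so the two cycles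
    are distinct even if p = r.\<close>
  have 1: "image_mset card (mset_set (?O - {A})) = replicate_mset t 1 + {#r#}"
    using type mset_set.remove[OF fin A(1)] A(2) by simp
  then have "r \<in># image_mset card (mset_set (?O - {A}))" by simp
  then obtain Z where Z: "Z \<in> ?O - {A}" "card Z = r"
    using fin by auto
  have 2: "image_mset card (mset_set (?O - {A} - {Z})) = replicate_mset t 1"
    using 1 mset_set.remove[OF _ Z(1)] Z(2) fin by simp
  have "A \<in> ?O" "Z \<in> ?O"
    using A(1) Z(1) by auto
  then obtain a z where az: "a \<in> {1..n}" "A = orbit \<sigma> a" "z \<in> {1..n}" "Z = orbit \<sigma> z"
    unfolding perm_cycles_def by blast
  have "z \<notin> orbit \<sigma> a"
    using Z(1) orbit_eq_iff[OF perm, of a z] by (auto simp: az)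
  moreover have "\<sigma> f = f" if f: "f \<in> {1..n} - (orbit \<sigma> a \<union> orbit \<sigma> z)" for f
  proof -
    have self: "f \<in> orbit \<sigma> f" by (rule permutation_self_in_orbit[OF perm])
    then have "orbit \<sigma> f \<in> ?O - {A} - {Z}"
      using f by (auto simp: perm_cycles_def az)
    then have "card (orbit \<sigma> f) \<in># image_mset card (mset_set (?O - {A} - {Z}))"
      using fin by simp
    then have "card (orbit \<sigma> f) = 1"
      unfolding 2 by (simp split: if_splits)
    then have "orbit \<sigma> f = {f}"
      using self by (metis card_1_singletonE singletonD)
    then show ?thesis by (simp add: orbit_eq_singleton_iff)
  qed
  ultimately show ?thesis
    using that[of a z] az A(2) Z(2) by blast
qed

text \<open>Ensures that the quotient in the theorem has a nonzero denominator. The witness rotates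
  two adjacent intervals and fixes the other points.\<close>

lemma cycle_type_two_cycles_nonempty:
  assumes "p \<ge> 1" "r \<ge> 1" "n = p + r + t"
  shows "\<exists>\<sigma>. \<sigma> permutes {1..n} \<and> cycle_type n \<sigma> = replicate_mset t 1 + {#p, r#}"
proof -
  \<comment> \<open>The wrap-around cases come first, so an interval of length 1 becomes a fixed
    point.\<close>
  define f where "f x = (if x = p then 1 else if x = p + r then p + 1
     else if 1 \<le> x \<and> x < p + r then x + 1 else x)" for x
  have "f permutes {1..n}"
  proof (rule bij_imp_permutes)
    have "inj_on f {1..n}" "f ` {1..n} \<subseteq> {1..n}"
      using assms by (auto simp: f_def inj_on_def split: if_splits)
    then show "bij_betw f {1..n} {1..n}"
      using endo_inj_surj[of "{1..n}"] by (auto simp: bij_betw_def)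
  qed (use assms in \<open>auto simp: f_def\<close>)
  moreover have "cycle_type n f = replicate_mset t 1 + {#p, r#}"
  proof -
    let ?S = "(\<lambda>x. {x}) ` {p + r + 1..n}"
    have o1: "orbit f x = {1..p}" if "x \<in> {1..p}" for x
      by (rule orbit_eq_interval) (use that assms in \<open>auto simp: f_def\<close>)
    have o2: "orbit f x = {p+1..p+r}" if "x \<in> {p+1..p+r}" for x
      by (rule orbit_eq_interval) (use that assms in \<open>auto simp: f_def\<close>)
    have o3: "orbit f x = {x}" if "x \<in> {p+r+1..n}" for x
      using that assms by (simp add: orbit_eq_singleton_iff f_def)
    have split: "{1..n} = {1..p} \<union> {p+1..p+r} \<union> {p+r+1..n}"
      using assms by auto
    have "orbit f ` {1..p} = {{1..p}}" "orbit f ` {p+1..p+r} = {{p+1..p+r}}" "orbit f ` {p+r+1..n} = ?S"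
      using o1 o2 o3 assms by (auto simp: image_def)
    then have pc: "perm_cycles n f = {{1..p}, {p+1..p+r}} \<union> ?S"
      unfolding perm_cycles_def split image_Un by auto
    have disj: "{{1..p}, {p+1..p+r}} \<inter> ?S = {}"
    proof -
      have "y \<in> {p+r+1..n}" if "C \<in> ?S" "y \<in> C" for C y
        using that by auto
      moreover have "1 \<in> {1..p}" "p + 1 \<in> {p+1..p+r}" "1 \<notin> {p+r+1..n}" "p + 1 \<notin> {p+r+1..n}"
        using assms by auto
      ultimately show ?thesis by blast
    qed
    have ne: "{1..p} \<noteq> {p+1..p+r}"
    proof -
      have "1 \<in> {1..p}" "1 \<notin> {p+1..p+r}" using assms by auto
      then show ?thesis by blast
    qed
    have "image_mset card (mset_set ?S) = replicate_mset t 1"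
      using assms by (simp add: image_mset_mset_set[symmetric] multiset.map_comp comp_def image_mset_const_eq)
    then show ?thesis
      using disj ne unfolding cycle_type_def pc by (subst mset_set_Union) simp_all
  qed
  ultimately show ?thesis by blast
qed

text \<open>Grouping the long cycles by their cycle count makes these cardinalities the coefficients
  of a polynomial in x. The two expressions for it agree at every real x, so their coefficients
  agree.\<close>

lemma card_long_cycles_quotient:
  assumes \<sigma>: "\<sigma> permutes {1..n}" and type: "cycle_type n \<sigma> = replicate_mset t 1 + {#p, r#}"
    and n: "n = p + r + t" "r \<ge> 1" and m: "m \<le> n"
  shows "real (card {w \<in> long_cycles {1..n}. cycle_count {1..n} (inv \<sigma> \<circ> w) = m}) =
    fact (n - 1) * hook_weight p (p + r) m"
proof -
  let ?L = "long_cycles {1..n}"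
  let ?k = "\<lambda>m. card {w \<in> ?L. cycle_count {1..n} (inv \<sigma> \<circ> w) = m}"
  have fin: "finite ?L"
    by (rule finite_subset[OF _ finite_permutations[of "{1..n}"]]) (auto simp: long_cycles_def)
  obtain a z where az: "a \<in> {1..n}" "z \<in> {1..n}" "z \<notin> orbit \<sigma> a"
    "card (orbit \<sigma> a) = p" "card (orbit \<sigma> z) = r"
    "\<forall>f\<in>{1..n} - (orbit \<sigma> a \<union> orbit \<sigma> z). \<sigma> f = f"
    using cycle_type_two_cycles[OF \<sigma> type] .
  have "(\<Sum>m\<le>n. real (?k m) * x ^ m) = (\<Sum>m\<le>n. fact (n - 1) * hook_weight p (p + r) m * x ^ m)" for x
  proof -
    have "(\<Sum>w\<in>?L. x ^ cycle_count {1..n} (inv \<sigma> \<circ> w)) = (\<Sum>m\<le>n. \<Sum>w\<in>{w \<in> ?L. cycle_count {1..n} (inv \<sigma> \<circ> w) = m}.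
        x ^ cycle_count {1..n} (inv \<sigma> \<circ> w))"
      by (rule sum.group[symmetric]) (use fin cycle_count_le[of "{1..n}"] in auto)
    then have "(\<Sum>m\<le>n. real (?k m) * x ^ m) = (\<Sum>w\<in>?L. x ^ cycle_count {1..n} (inv \<sigma> \<circ> w))"
      by simp
    also have "\<dots> = fact (n - 1) / fact (p + r) *
      (\<Sum>i<p. pochhammer (x - real i) (p + r) - pochhammer (x - real (i + r)) (p + r))"
      using long_cycle_sum_two_cycles[OF _ az(1,2) \<sigma> az(3) bspec[OF az(6)] az(4,5), of x] by simp
    also have "\<dots> = fact (n - 1) * (\<Sum>m\<le>n. hook_weight p (p + r) m * x ^ m)"
    proof -
      have "p + r \<le> n" using n by simp
      then show ?thesis
        by (simp only: pochhammer_difference_eq_hook_weight[OF refl n(2), symmetric] times_divide_eq_right times_divide_eq_left)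
    qed
    finally show ?thesis
      by (simp add: sum_distrib_left mult.assoc)
  qed
  then show ?thesis
    using polyfun_eq_coeffs[of "\<lambda>m. real (?k m)" n "\<lambda>m. fact (n - 1) * hook_weight p (p + r) m"] m by simp
qed

text \<open>Double counting of pairs of a permutation in the class and a long cycle:
  \<open>mu\<close> is constant over the (n - 1)! long cycles, and the number of suitable long
  cycles is constant over the class. The common factor (n - 1)! cancels.\<close>

lemma mu_eq_conj_class_size_mult:
  assumes n: "n = p + r + t" "p \<ge> 1" "r \<ge> 1"
  defines "\<gamma> \<equiv> replicate_mset t 1 + {#p, r#}"
  shows "real (mu n m \<gamma>) = real (conj_class_size n \<gamma>) * hook_weight p (p + r) m"
proof (cases "m \<le> n")
  case True
  let ?U = "{1..n}"
  let ?L = "long_cycles ?U"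
  define C where "C = {\<sigma>. \<sigma> permutes ?U \<and> cycle_type n \<sigma> = \<gamma>}"
  let ?P = "\<lambda>\<sigma> w. cycle_count ?U (inv \<sigma> \<circ> w) = m"
  have finP: "finite {\<sigma>. \<sigma> permutes ?U}" by (simp add: finite_permutations)
  have finL: "finite ?L" and finC: "finite C"
    by (rule finite_subset[OF _ finP]; auto simp: long_cycles_def C_def)+
  have "fact (n - 1) * mu n m \<gamma> = (\<Sum>w\<in>?L. mu n m \<gamma>)"
    using card_long_cycles[of ?U] n by simp
  also have "\<dots> = (\<Sum>w\<in>?L. card {\<sigma> \<in> C. ?P \<sigma> w})"
    by (rule sum.cong) (use mu_eq_card_quotient[of n _ m \<gamma>] n in \<open>simp_all add: C_def conj_assoc\<close>)
  also have "\<dots> = (\<Sum>\<sigma>\<in>C. card {w \<in> ?L. ?P \<sigma> w})"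
    by (rule sum_multicount_gen) (use finL finC in auto)
  finally have "real (fact (n - 1) * mu n m \<gamma>) = (\<Sum>\<sigma>\<in>C. real (card {w \<in> ?L. ?P \<sigma> w}))"
    by simp
  also have "\<dots> = (\<Sum>\<sigma>\<in>C. fact (n - 1) * hook_weight p (p + r) m)"
    by (rule sum.cong) (use card_long_cycles_quotient[OF _ _ n(1,3) True] in \<open>auto simp: C_def \<gamma>_def\<close>)
  finally show ?thesis
    by (simp add: C_def conj_class_size_def)
next
  \<comment> \<open>Both sides vanish: n points allow at most n cycles, and every j in the sum is at
    most n < m, where the Stirling number is 0.\<close>
  case False
  have "{(\<sigma>, \<pi>). \<sigma> permutes {1..n} \<and> \<pi> permutes {1..n} \<and>
      \<sigma> \<circ> \<pi> = long_cycle n \<and> cycle_type n \<sigma> = \<gamma> \<and> num_cycles n \<pi> = m} = {}"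
    using False cycle_count_le[of "{1..n}"] by (auto simp: num_cycles_eq)
  then have "mu n m \<gamma> = 0"
    by (simp only: mu_def card.empty)
  moreover have "hook_weight p (p + r) m = 0"
    unfolding hook_weight_def by (rule sum.neutral) (use False n in auto)
  ultimately show ?thesis by simp
qed

text \<open>The exponent of the theorem can be negative and is an integer there; only its parity
  matters.\<close>

lemma minus_one_powi_diff: "(-1::real) powi (int j - int m) = (-1) ^ (j + m)"
  by (cases "even m") (simp_all add: power_int_diff power_add)

theorem theorem4p8:
  fixes n m t p :: nat
  assumes "m > 0" and "p \<ge> 1" and "n \<ge> p + t + 1"
  defines "\<gamma> \<equiv> replicate_mset t 1 + {#p, n - p - t#}"
  shows "(odd (int n - int m - int t) \<longrightarrow>
           real (mu n m \<gamma>) / real (conj_class_size n \<gamma>) =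
             (\<Sum>j=1..n-t. ((-1::real) ^ (n - j - t) - (-1::real) powi (int j - int m))
                 / fact j * real (p choose (n + 1 - j - t)) * real (stirling j m)))
       \<and> (even (int n - int m - int t) \<longrightarrow> mu n m \<gamma> = 0)"
proof -
  define r where "r = n - p - t"
  have r: "n = p + r + t" "r \<ge> 1" "n - t = p + r"
    using assms by (auto simp: r_def)
  have mu: "real (mu n m \<gamma>) = real (conj_class_size n \<gamma>) * hook_weight p (p + r) m"
    unfolding \<gamma>_def r_def[symmetric] by (rule mu_eq_conj_class_size_mult[OF r(1) assms(2) r(2)])
  obtain \<sigma> where "\<sigma> permutes {1..n} \<and> cycle_type n \<sigma> = \<gamma>"
    using cycle_type_two_cycles_nonempty[OF assms(2) r(2,1)] by (auto simp: \<gamma>_def r_def)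
  moreover have "finite {\<sigma>. \<sigma> permutes {1..n} \<and> cycle_type n \<sigma> = \<gamma>}"
    by (rule finite_subset[OF _ finite_permutations[of "{1..n}"]]) auto
  ultimately have "conj_class_size n \<gamma> \<noteq> 0"
    by (auto simp: conj_class_size_def)
  then have "real (mu n m \<gamma>) / real (conj_class_size n \<gamma>) = hook_weight p (p + r) m"
    by (simp add: mu)
  also have "\<dots> = (\<Sum>j=1..n-t. ((-1::real) ^ (n - j - t) - (-1::real) powi (int j - int m))
                 / fact j * real (p choose (n + 1 - j - t)) * real (stirling j m))"
    unfolding hook_weight_def r(3)
  proof (rule sum.cong)
    fix j assume "j \<in> {1..p + r}"
    then have "p + r - j = n - j - t" "p + r + 1 - j = n + 1 - j - t"
      using r(1) by auto
    then show "((-1) ^ (p + r - j) - (-1) ^ (j + m)) / fact j * real (p choose (p + r + 1 - j)) * real (stirling j m) =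
       ((-1::real) ^ (n - j - t) - (-1::real) powi (int j - int m))
                 / fact j * real (p choose (n + 1 - j - t)) * real (stirling j m)"
      by (simp add: minus_one_powi_diff)
  qed simp
  finally have "real (mu n m \<gamma>) / real (conj_class_size n \<gamma>) = \<dots>" .
  \<comment> \<open>Since n - t = p + r, the parity assumption makes the two signs equal for each j,
    so the sum vanishes term by term.\<close>
  moreover have "mu n m \<gamma> = 0" if "even (int n - int m - int t)"
  proof -
    have "even (p + r + m)"
      using that r(1) by presburger
    have "hook_weight p (p + r) m = 0"
      unfolding hook_weight_def
    proof (rule sum.neutral, rule ballI)
      fix j assume "j \<in> {1..p + r}"
      then have "even (p + r - j) \<longleftrightarrow> even (j + m)"
        using \<open>even (p + r + m)\<close> by auto
      then have "(-1) ^ (p + r - j) = ((-1) ^ (j + m) :: real)"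
        by (simp add: minus_one_power_iff)
      then show "((-1) ^ (p + r - j) - (-1) ^ (j + m)) / fact j *
         real (p choose (p + r + 1 - j)) * real (stirling j m) = 0"
        by simp
    qed
    then show ?thesis
      using mu by simp
  qed
  ultimately show ?thesis by blast
qed

end
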